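(* Let $\Omega\subset\mathbb{R}^N$ be an open set, $1<p\le N$ and $u\in W^{1,p}(\Omega)$. Then $$\lim_{\rho\to0^+}\fint_{B_\rho(x)}|u(y)-u_{B_\rho(x)}|^p\,dy=0\qquad\text{for }\mathcal{H}^{N-p}\text{-a.e. }x\in\Omega .$$ That is, $\mathcal{H}^{N-p}(\mathcal{S}'_u)=0$.
   Context: $N$ is a natural number. $\mathcal{H}^{s}$ is $s$-dimensional Hausdorff measure, $\fint$ denotes the average with respect to Lebesgue measure, and $u_{B_\rho(x)}:=\fint_{B_\rho(x)}u(w)\,dw$. $W^{1,p}(\Omega)$ is the usual Sobolev space of real-valued functions. For $u\in L^1_{loc}(\Omega)$, $\mathcal{S}'_u$ is the set of points $x\in\Omega$ for which the property $$\lim_{\rho\to0^+}\left(\inf_{c\in\mathbb{R}}\fint_{B_\rho(x)}|u(y)-c|\,dy\right)=0$$ does not hold. *)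

theory Defs
  imports "HOL-Analysis.Analysis"
begin

section \<open>Hausdorff measure\<close>

text \<open>
  The summand \<open>\<omega>\<^sub>s (diam E / 2)\<^sup>s\<close>. The empty set has weight \<open>0\<close> and \<open>diam\<^sup>0 = 1\<close> for
  nonempty sets (so that \<open>s = 0\<close> yields counting measure); the latter must be spelled out
  because \<open>0 powr 0 = 0\<close>.
\<close>

definition hausdorff_weight :: "real \<Rightarrow> 'a::metric_space set \<Rightarrow> real" where
  "hausdorff_weight s E =
     (if E = {} then 0
      else unit_ball_vol s * (if s = 0 then 1 else (diameter E / 2) powr s))"

text \<open>
  Boundedness is required explicitly because \<^const>\<open>diameter\<close> is \<open>0\<close> on unbounded sets.
\<close>

definition hausdorff_premeasure :: "real \<Rightarrow> real \<Rightarrow> 'a::metric_space set \<Rightarrow> ennreal" where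
  "hausdorff_premeasure s \<delta> A =
     (INF C \<in> {C :: nat \<Rightarrow> 'a set. A \<subseteq> (\<Union>i. C i) \<and> (\<forall>i. bounded (C i) \<and> diameter (C i) \<le> \<delta>)}.
        \<Sum>i. ennreal (hausdorff_weight s (C i)))"

text \<open>As an outer measure, defined on all subsets.\<close>

definition hausdorff_measure :: "real \<Rightarrow> 'a::metric_space set \<Rightarrow> ennreal" where
  "hausdorff_measure s A = (SUP \<delta> \<in> {0<..}. hausdorff_premeasure s \<delta> A)"


section \<open>Sobolev functions\<close>

primrec C_k :: "nat \<Rightarrow> ('a::euclidean_space \<Rightarrow> real) \<Rightarrow> bool" where
  "C_k 0 f \<longleftrightarrow> continuous_on UNIV f"
| "C_k (Suc k) f \<longleftrightarrow>
     (\<forall>x. f differentiable (at x)) \<and>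
     (\<forall>i\<in>Basis. C_k k (\<lambda>x. frechet_derivative f (at x) i))"

definition test_function :: "'a::euclidean_space set \<Rightarrow> ('a \<Rightarrow> real) \<Rightarrow> bool" where
  "test_function \<Omega> \<phi> \<longleftrightarrow>
     (\<forall>k. C_k k \<phi>) \<and> compact (closure {x. \<phi> x \<noteq> 0}) \<and> closure {x. \<phi> x \<noteq> 0} \<subseteq> \<Omega>"

definition locally_integrable_on :: "('a::euclidean_space \<Rightarrow> real) \<Rightarrow> 'a set \<Rightarrow> bool" where
  "locally_integrable_on u \<Omega> \<longleftrightarrow>
     (\<forall>K. compact K \<and> K \<subseteq> \<Omega> \<longrightarrow> integrable (lebesgue_on K) u)"

definition weak_partial_derivative ::
    "'a::euclidean_space set \<Rightarrow> 'a \<Rightarrow> ('a \<Rightarrow> real) \<Rightarrow> ('a \<Rightarrow> real) \<Rightarrow> bool" where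
  "weak_partial_derivative \<Omega> i u g \<longleftrightarrow>
     locally_integrable_on u \<Omega> \<and> locally_integrable_on g \<Omega> \<and>
     (\<forall>\<phi>. test_function \<Omega> \<phi> \<longrightarrow>
        integral\<^sup>L (lebesgue_on \<Omega>) (\<lambda>x. u x * frechet_derivative \<phi> (at x) i)
          = - integral\<^sup>L (lebesgue_on \<Omega>) (\<lambda>x. g x * \<phi> x))"

text \<open>
  \<open>L\<^sup>p\<close> and \<open>W\<^sup>1\<^sup>,\<^sup>p\<close> consist here of functions rather than of their classes modulo null sets;
  the functions are total, and their values outside \<open>\<Omega>\<close> are irrelevant.
\<close>

definition Lp :: "real \<Rightarrow> 'a::euclidean_space set \<Rightarrow> ('a \<Rightarrow> real) set" where
  "Lp p \<Omega> = {f. f \<in> borel_measurable (lebesgue_on \<Omega>) \<and>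
                integrable (lebesgue_on \<Omega>) (\<lambda>x. \<bar>f x\<bar> powr p)}"

definition W1p :: "real \<Rightarrow> 'a::euclidean_space set \<Rightarrow> ('a \<Rightarrow> real) set" where
  "W1p p \<Omega> = {u \<in> Lp p \<Omega>. \<forall>i\<in>Basis. \<exists>g\<in>Lp p \<Omega>. weak_partial_derivative \<Omega> i u g}"


section \<open>Averages and the exceptional set\<close>

definition average :: "'a::euclidean_space set \<Rightarrow> ('a \<Rightarrow> real) \<Rightarrow> real" where
  "average S f = integral\<^sup>L (lebesgue_on S) f / measure lebesgue S"

text \<open>The set \<open>\<S>'\<^sub>u\<close>, meaningful for \<open>u\<close> locally integrable on \<open>\<Omega>\<close>.\<close>

definition singular_set :: "'a::euclidean_space set \<Rightarrow> ('a \<Rightarrow> real) \<Rightarrow> 'a set" where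
  "singular_set \<Omega> u =
     {x \<in> \<Omega>. \<not> ((\<lambda>\<rho>. INF c::real. average (ball x \<rho>) (\<lambda>y. \<bar>u y - c\<bar>)) \<longlongrightarrow> 0) (at_right 0)}"

end

theory Submission
  imports Defs
begin

text \<open>
  Testing the weak gradient against explicit smooth bumps, and integrating their translates along a
  segment, gives \<open>u (x + h) - u x = \<integral>\<^sub>0\<^sup>1 h \<bullet> \<nabla>u (x + t h) dt\<close> for almost every \<open>x\<close>; no mollification of \<open>u\<close> is
  needed. By Jensen and Tonelli this yields the Poincare inequality on balls, which bounds the mean
  oscillation on \<open>B\<^sub>\<rho>(x)\<close> by a constant times \<open>\<rho>\<^sup>p\<^sup>-\<^sup>N \<nu>(B\<^sub>\<rho>(x))\<close>, where \<open>\<nu>\<close> is the finite measure with density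
  comparable to \<open>|\<nabla>u|\<^sup>p\<close>. A Vitali covering argument shows that the points where this quantity does
  not tend to \<open>0\<close> form an \<open>\<H>\<^sup>N\<^sup>-\<^sup>p\<close>-null set.
\<close>

section \<open>Smooth bumps\<close>

text \<open>The exponent is dictated by scaling: Poincare's inequality contributes
  \<open>\<rho> powr p\<close> and averaging divides by a volume of order \<open>\<rho> ^ N\<close>,
  so a point where the oscillation fails to decay sees \<open>\<nu>\<close>-mass at least a fixed
  multiple of \<open>\<rho> powr (N - p)\<close> on arbitrarily small balls. For p = N this is a
  fixed amount of mass near the point, the exceptional set is empty, and the same estimates apply
  with s = 0. The obstacle is to pass from the weak gradient, visible only through test functions,
  to differences of u. A test function has iterated partial derivatives of all orders, so the bumps
  are drawn from a class closed under differentiation, where smoothness is an induction. They need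
  only approximate indicators of boxes, because boxes generate the Borel sets. Segments must stay in
  the domain, which is why the argument is confined to convex sets. The null set of exceptional x
  depends on h; this is harmless, since h is fixed while x is integrated and is integrated only
  afterwards.\<close>

definition flat :: "nat \<Rightarrow> real \<Rightarrow> real" where
  "flat m s = (if s \<le> 0 then 0 else (1 / s) ^ m * exp (- 1 / s))"

lemma flat_tendsto_0: "((\<lambda>s. flat m s) \<longlongrightarrow> 0) (at_right 0)"
proof -
  have "((\<lambda>s::real. inverse s ^ m / exp (inverse s)) \<longlongrightarrow> 0) (at_right 0)"
    by (rule filterlim_compose[OF tendsto_power_div_exp_0 filterlim_inverse_at_top_right])
  then show ?thesis
    by (rule Lim_transform_eventually)
       (auto simp: eventually_at_filter flat_def exp_minus field_simps)
qed

text \<open>Differentiating \<open>s^(-m) e^(-1/s)\<close> only raises the power of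
  \<open>1/s\<close>, which is why the family carries the index \<open>m\<close>: its span is closed
  under differentiation, also at the junction \<open>s = 0\<close>.\<close>

lemma flat_has_real_derivative:
  "(flat m has_real_derivative flat (m + 2) s - m * flat (m + 1) s) (at s)"
proof (cases s "0::real" rule: linorder_cases)
  case less
  have "((\<lambda>_. 0) has_real_derivative flat (m + 2) s - m * flat (m + 1) s) (at s)"
    using less by (simp add: flat_def)
  then show ?thesis
    by (rule has_field_derivative_transform_within_open[OF _ open_lessThan[of 0]])
       (use less in \<open>auto simp: flat_def\<close>)
next
  case equal
  have "((\<lambda>h. flat m h / h) \<longlongrightarrow> 0) (at 0)"
  proof (rule filterlim_split_at)
    show "((\<lambda>h. flat m h / h) \<longlongrightarrow> 0) (at_left 0)"
      by (rule tendsto_eventually) (auto simp: flat_def eventually_at_filter)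
    \<comment> \<open>For positive \<open>h\<close> the quotient is
      \<open>flat (Suc m) h\<close>.\<close>
    show "((\<lambda>h. flat m h / h) \<longlongrightarrow> 0) (at_right 0)"
      by (rule Lim_transform_eventually[OF flat_tendsto_0[of "Suc m"]])
         (auto simp: eventually_at_filter flat_def)
  qed
  then show ?thesis
    using equal by (simp add: DERIV_def flat_def)
next
  case greater
  have "((\<lambda>s. (1 / s) ^ m * exp (- 1 / s)) has_real_derivative
      flat (m + 2) s - m * flat (m + 1) s) (at s)"
  proof (cases m)
    case 0
    show ?thesis
      unfolding 0 using greater
      by (auto intro!: derivative_eq_intros simp: flat_def field_simps power2_eq_square)
  next
    case (Suc k)
    show ?thesis
      unfolding Suc using greater
      by (auto intro!: derivative_eq_intros simp: flat_def field_simps power2_eq_square) (cases k; simp)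
  qed
  then show ?thesis
    by (rule has_field_derivative_transform_within_open[OF _ open_greaterThan[of 0]])
       (use greater in \<open>auto simp: flat_def\<close>)
qed

text \<open>With \<open>t = 1 / s\<close>, the upper bound is one term of the exponential series:
  \<open>t ^ m / fact m \<le> exp t\<close>. Its case \<open>m = 0\<close> keeps the box bumps
  between 0 and 1.\<close>

lemma flat_bounds: "0 \<le> flat m s" "flat m s \<le> fact m"
proof -
  show "0 \<le> flat m s" by (simp add: flat_def)
  have "t ^ m \<le> fact m * exp t" if "t \<ge> 0" for t :: real
  proof -
    have "t ^ m /\<^sub>R fact m \<le> (\<Sum>n<Suc m. t ^ n /\<^sub>R fact n)"
      using that by (intro member_le_sum) auto
    also have "\<dots> \<le> exp t"
      unfolding exp_def using that by (intro sum_le_suminf summable_exp_generic) auto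
    finally show ?thesis by (simp add: field_simps)
  qed
  from this[of "1 / s"] show "flat m s \<le> fact m"
    by (auto simp: flat_def exp_minus field_simps)
qed

lemma flat_0_tendsto_1: "((\<lambda>n. flat 0 (real (Suc n) * c - 1)) \<longlonglongrightarrow> 1)" if "c > 0"
proof -
  have "filterlim (\<lambda>n. - 1 + c * real (Suc n)) at_top sequentially"
    by (intro filterlim_tendsto_add_at_top[OF tendsto_const]
        filterlim_tendsto_pos_mult_at_top[OF tendsto_const that]
        filterlim_compose[OF filterlim_real_sequentially filterlim_Suc])
  then have top: "filterlim (\<lambda>n. real (Suc n) * c - 1) at_top sequentially"
    by (simp add: algebra_simps)
  have "((\<lambda>s::real. exp (- inverse s)) \<longlongrightarrow> exp (- 0)) at_top"
    by (intro tendsto_intros tendsto_inverse_0_at_top filterlim_ident)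
  then have "((\<lambda>s::real. exp (- 1 / s)) \<longlongrightarrow> 1) at_top"
    by (simp add: divide_inverse)
  then have "((\<lambda>s::real. flat 0 s) \<longlongrightarrow> 1) at_top"
    by (rule Lim_transform_eventually)
       (use eventually_gt_at_top[of 0] in eventually_elim, auto simp: flat_def)
  from filterlim_compose[OF this top] show ?thesis .
qed

text \<open>
  Closed under translations and partial derivatives, so that all members are \<open>C\<^sup>k\<close> for every \<open>k\<close>.
\<close>

inductive_set bump_algebra :: "('a::euclidean_space \<Rightarrow> real) set" where
  const: "(\<lambda>x. c) \<in> bump_algebra"
| flat: "(\<lambda>x. flat m (x \<bullet> b + \<beta>)) \<in> bump_algebra"
| add: "f \<in> bump_algebra \<Longrightarrow> g \<in> bump_algebra \<Longrightarrow> (\<lambda>x. f x + g x) \<in> bump_algebra"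
| mult: "f \<in> bump_algebra \<Longrightarrow> g \<in> bump_algebra \<Longrightarrow> (\<lambda>x. f x * g x) \<in> bump_algebra"

lemma bump_algebra_prod:
  "finite I \<Longrightarrow> (\<And>i. i \<in> I \<Longrightarrow> f i \<in> bump_algebra) \<Longrightarrow> (\<lambda>x. \<Prod>i\<in>I. f i x) \<in> bump_algebra"
  by (induction I rule: finite_induct) (auto intro: bump_algebra.intros)

lemma bump_algebra_translate: "f \<in> bump_algebra \<Longrightarrow> (\<lambda>x. f (x - h)) \<in> bump_algebra"
proof (induction rule: bump_algebra.induct)
  case (flat m b \<beta>)
  have "(\<lambda>x. flat m ((x - h) \<bullet> b + \<beta>)) = (\<lambda>x. flat m (x \<bullet> b + (\<beta> - h \<bullet> b)))"
    by (simp add: inner_diff_left algebra_simps)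
  then show ?case by (simp add: bump_algebra.flat)
qed (auto intro: bump_algebra.intros)

text \<open>Directions \<open>i\<close> range over the whole space, not just \<open>Basis\<close>,
  because test functions are later differentiated along an arbitrary translation
  \<open>h\<close>.\<close>

lemma bump_algebra_deriv:
  "f \<in> bump_algebra \<Longrightarrow>
    \<exists>f'. (\<forall>x. (f has_derivative f' x) (at x)) \<and> (\<forall>i. (\<lambda>x. f' x i) \<in> bump_algebra)"
proof (induction rule: bump_algebra.induct)
  case (const c)
  show ?case by (rule exI[of _ "\<lambda>_ _. 0"]) (auto intro: bump_algebra.intros)
next
  case (flat m b \<beta>)
  \<comment> \<open>Written as a sum with a constant factor, to match the closure rules of
    \<open>bump_algebra\<close> literally.\<close>
  define D where "D = (\<lambda>x. flat (m + 2) x + (- m) * flat (m + 1) x)"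
  have "((\<lambda>x. flat m (x \<bullet> b + \<beta>)) has_derivative (\<lambda>i. D (x \<bullet> b + \<beta>) * (i \<bullet> b))) (at x)" for x
  proof -
    have "(flat m has_derivative (*) (D (x \<bullet> b + \<beta>))) (at (x \<bullet> b + \<beta>))"
      using flat_has_real_derivative[of m "x \<bullet> b + \<beta>"] by (simp add: has_field_derivative_def D_def)
    then show ?thesis
      by (rule has_derivative_compose[rotated]) (auto intro!: derivative_eq_intros)
  qed
  moreover have "(\<lambda>x. D (x \<bullet> b + \<beta>) * (i \<bullet> b)) \<in> bump_algebra" for i
    unfolding D_def by (intro bump_algebra.intros)
  ultimately show ?case
    by (intro exI[of _ "\<lambda>x i. D (x \<bullet> b + \<beta>) * (i \<bullet> b)"]) blast
next
  case (add f g)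
  from add.IH obtain f' g' where
    "\<forall>x. (f has_derivative f' x) (at x)" "\<forall>i. (\<lambda>x. f' x i) \<in> bump_algebra"
    "\<forall>x. (g has_derivative g' x) (at x)" "\<forall>i. (\<lambda>x. g' x i) \<in> bump_algebra" by blast
  then show ?case
    by (intro exI[of _ "\<lambda>x i. f' x i + g' x i"])
       (auto intro!: has_derivative_add bump_algebra.intros)
next
  case (mult f g)
  from mult.IH obtain f' g' where
    "\<forall>x. (f has_derivative f' x) (at x)" "\<forall>i. (\<lambda>x. f' x i) \<in> bump_algebra"
    "\<forall>x. (g has_derivative g' x) (at x)" "\<forall>i. (\<lambda>x. g' x i) \<in> bump_algebra" by blast
  with mult.hyps show ?case
    by (intro exI[of _ "\<lambda>x i. f x * g' x i + f' x i * g x"])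
       (auto intro!: has_derivative_mult bump_algebra.intros)
qed

lemma
  assumes "f \<in> bump_algebra"
  shows bump_algebra_has_derivative: "(f has_derivative frechet_derivative f (at x)) (at x)"
    and bump_algebra_frechet_derivative: "(\<lambda>x. frechet_derivative f (at x) i) \<in> bump_algebra"
proof -
  obtain f' where f': "\<forall>x. (f has_derivative f' x) (at x)" "\<forall>i. (\<lambda>x. f' x i) \<in> bump_algebra"
    using bump_algebra_deriv[OF assms] by blast
  then have "frechet_derivative f (at x) = f' x" for x
    using frechet_derivative_at[of f "f' x" x] by simp
  then show "(f has_derivative frechet_derivative f (at x)) (at x)"
    "(\<lambda>x. frechet_derivative f (at x) i) \<in> bump_algebra"
    using f' by auto
qed

lemma bump_algebra_continuous: "f \<in> bump_algebra \<Longrightarrow> continuous_on S f"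
  using bump_algebra_has_derivative has_derivative_continuous
  by (blast intro: continuous_at_imp_continuous_on)

lemma bump_algebra_C_k: "f \<in> bump_algebra \<Longrightarrow> C_k k f"
  by (induction k arbitrary: f)
     (auto simp: bump_algebra_continuous bump_algebra_frechet_derivative differentiable_def
       intro: bump_algebra_has_derivative)

text \<open>The generators are bounded on the whole line, and sums and products preserve this. It
  makes products of integrable functions with members of the algebra integrable, and supplies the
  dominating functions for Fubini's theorem.\<close>

lemma bump_algebra_bounded: "f \<in> bump_algebra \<Longrightarrow> \<exists>M. \<forall>x. \<bar>f x\<bar> \<le> M"
proof (induction rule: bump_algebra.induct)
  case (flat m b \<beta>)
  show ?case using flat_bounds[of m] by (intro exI[of _ "fact m"]) auto
next
  case (add f g)
  then obtain A B where "\<forall>x. \<bar>f x\<bar> \<le> A" "\<forall>x. \<bar>g x\<bar> \<le> B" by blast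
  then have "\<bar>f x + g x\<bar> \<le> A + B" for x
    by (meson abs_triangle_ineq add_mono order_trans)
  then show ?case by blast
next
  case (mult f g)
  then obtain A B where AB: "\<forall>x. \<bar>f x\<bar> \<le> A" "\<forall>x. \<bar>g x\<bar> \<le> B" by blast
  have "\<bar>f x * g x\<bar> \<le> A * B" for x
    unfolding abs_mult using AB by (intro mult_mono) (auto intro: order_trans[OF abs_ge_zero])
  then show ?case by blast
qed auto

text \<open>There is one factor per face of the box, switched off within distance
  \<open>1 / Suc n\<close> of that face. Hence the support lies in a smaller closed box, while at a
  fixed interior point every factor tends to 1. The uniform bound 1 prepares dominated
  convergence.\<close>

lemma box_bumps:
  fixes a b :: "'a::euclidean_space"
  obtains \<phi> :: "nat \<Rightarrow> 'a \<Rightarrow> real" where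
    "\<And>n. \<phi> n \<in> bump_algebra"
    "\<And>n. compact (closure {x. \<phi> n x \<noteq> 0})"
    "\<And>n. closure {x. \<phi> n x \<noteq> 0} \<subseteq> box a b"
    "\<And>n x. \<bar>\<phi> n x\<bar> \<le> 1"
    "\<And>x. (\<lambda>n. \<phi> n x) \<longlonglongrightarrow> indicator (box a b) x"
proof
  define \<phi> where "\<phi> n x = (\<Prod>i\<in>Basis. flat 0 (real (Suc n) * (x \<bullet> i - a \<bullet> i) - 1)
      * flat 0 (real (Suc n) * (b \<bullet> i - x \<bullet> i) - 1))" for n and x :: 'a
  \<comment> \<open>Each factor is put in the form \<open>flat 0 (x \<bullet> b + \<beta>)\<close>
    of the generators.\<close>
  have eq: "\<phi> n = (\<lambda>x. \<Prod>i\<in>Basis. flat 0 (x \<bullet> (real (Suc n) *\<^sub>R i) + (- real (Suc n) * (a \<bullet> i) - 1))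
      * flat 0 (x \<bullet> (- real (Suc n) *\<^sub>R i) + (real (Suc n) * (b \<bullet> i) - 1)))" for n
    unfolding \<phi>_def by (simp add: algebra_simps)
  show "\<phi> n \<in> bump_algebra" for n
    unfolding eq by (intro bump_algebra_prod bump_algebra.intros) auto
  define K where "K n = cbox (a + (1 / real (Suc n)) *\<^sub>R One) (b - (1 / real (Suc n)) *\<^sub>R One)" for n
  have sub: "{x. \<phi> n x \<noteq> 0} \<subseteq> K n" for n
    unfolding K_def cbox_def
  proof (intro subsetI CollectI ballI)
    fix x :: 'a and i :: 'a assume "x \<in> {x. \<phi> n x \<noteq> 0}" and i: "i \<in> Basis"
    then have nz: "\<phi> n x \<noteq> 0" by simp
    from nz i have "flat 0 (real (Suc n) * (x \<bullet> i - a \<bullet> i) - 1) \<noteq> 0"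
      "flat 0 (real (Suc n) * (b \<bullet> i - x \<bullet> i) - 1) \<noteq> 0"
      by (auto simp: \<phi>_def)
    then have "real (Suc n) * (x \<bullet> i - a \<bullet> i) > 1" "real (Suc n) * (b \<bullet> i - x \<bullet> i) > 1"
      by (auto simp: flat_def split: if_splits)
    then show "(a + (1 / real (Suc n)) *\<^sub>R One) \<bullet> i \<le> x \<bullet> i \<and> x \<bullet> i \<le> (b - (1 / real (Suc n)) *\<^sub>R One) \<bullet> i"
      using i by (simp add: inner_add_left inner_diff_left field_simps inner_sum_left_Basis)
  qed
  from sub have cl: "closure {x. \<phi> n x \<noteq> 0} \<subseteq> K n" for n
    by (intro closure_minimal) (auto simp: K_def)
  show "compact (closure {x. \<phi> n x \<noteq> 0})" for n
    by (rule compact_closure[THEN iffD2], rule bounded_subset[OF _ sub]) (auto simp: K_def bounded_cbox)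
  have Kbox: "K n \<subseteq> box a b" for n
  proof
    fix x assume "x \<in> K n"
    show "x \<in> box a b" unfolding mem_box
    proof
      fix i :: 'a assume i: "i \<in> Basis"
      have "a \<bullet> i + 1 / real (Suc n) \<le> x \<bullet> i" "x \<bullet> i \<le> b \<bullet> i - 1 / real (Suc n)"
        using \<open>x \<in> K n\<close> i
        by (auto simp: K_def mem_box inner_add_left inner_diff_left divide_inverse)
      moreover have "1 / real (Suc n) > 0" by simp
      ultimately show "a \<bullet> i < x \<bullet> i \<and> x \<bullet> i < b \<bullet> i" by linarith
    qed
  qed
  with cl show "closure {x. \<phi> n x \<noteq> 0} \<subseteq> box a b" for n by blast
  show "\<bar>\<phi> n x\<bar> \<le> 1" for n x
    unfolding \<phi>_def abs_prod using flat_bounds[of 0] by (intro prod_le_1) (auto intro!: mult_le_one simp: abs_mult)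
  show "(\<lambda>n. \<phi> n x) \<longlonglongrightarrow> indicator (box a b) x" for x
  proof (cases "x \<in> box a b")
    case True
    have "(\<lambda>n. \<phi> n x) \<longlonglongrightarrow> (\<Prod>i\<in>(Basis :: 'a set). 1 * 1)"
      unfolding \<phi>_def using True
      by (intro tendsto_prod tendsto_mult flat_0_tendsto_1) (auto simp: mem_box)
    with True show ?thesis by simp
  next
    case False
    then have "\<phi> n x = 0" for n using sub[of n] Kbox[of n] by auto
    with False show ?thesis by simp
  qed
qed

section \<open>Poincare's inequality on balls\<close>

text \<open>A Dynkin system argument: boxes are stable under intersection and generate the Borel
  sets, and vanishing of the integral passes to complements and countable disjoint unions.\<close>

lemma AE_zero_of_box_integrals:
  fixes v :: "'a::euclidean_space \<Rightarrow> real"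
  assumes v: "integrable lborel v" and box: "\<And>a b. (LINT x:box a b|lborel. v x) = 0"
  shows "AE x in lborel. v x = 0"
proof (rule sigma_finite_measure.density_zero[OF sigma_finite_lborel v])
  have si: "set_integrable lborel A v" if "A \<in> sets lborel" for A
    using v that unfolding set_integrable_def by (intro integrable_mult_indicator)
  \<comment> \<open>The whole space is not a box; exhausting it by boxes gives the vanishing total
    integral on which the complement case rests.\<close>
  let ?A = "\<lambda>n::nat. box (- (real n *\<^sub>R One)) (real n *\<^sub>R One) :: 'a set"
  have "incseq ?A"
    by (rule incseq_SucI) (fastforce simp: mem_box)
  then have "(\<lambda>n. LINT x:?A n|lborel. v x) \<longlonglongrightarrow> (LINT x:(\<Union>n. ?A n)|lborel. v x)"
    by (intro set_integral_cont_up si) auto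
  then have "(LINT x:(\<Union>n. ?A n)|lborel. v x) = 0"
    unfolding box by (rule LIMSEQ_unique) (rule tendsto_const)
  then have total: "(LINT x|lborel. v x) = 0"
    by (simp add: UN_box_eq_UNIV set_lebesgue_integral_def)
  fix A :: "'a set" assume A: "A \<in> sets lborel"
  let ?E = "range (\<lambda>(a, b). box a b) :: 'a set set"
  have E: "Int_stable ?E" "?E \<subseteq> Pow UNIV"
    by (auto simp: Int_stable_def box_Int_box)
  have eq: "sets lborel = sigma_sets UNIV ?E"
    by (simp add: borel_eq_box)
  with A have "A \<in> sigma_sets UNIV ?E" by simp
  with E show "(LINT x:A|lborel. v x) = 0"
  proof (induction rule: sigma_sets_induct_disjoint)
    case (basic A)
    then show ?case using box by auto
  next
    case (compl A)
    then have "A \<in> sets lborel" by (simp only: eq)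
    then have "(LINT x:(UNIV - A) \<union> A|lborel. v x) = (LINT x:UNIV - A|lborel. v x) + (LINT x:A|lborel. v x)"
      by (intro set_integral_Un si) auto
    with compl total show ?case by (simp add: set_lebesgue_integral_def)
  next
    case (union A)
    then have "\<And>i. A i \<in> sets lborel" using eq by blast
    then have "(LINT x:(\<Union>i. A i)|lborel. v x) = (\<Sum>i. (LINT x:(A i)|lborel. v x))"
      using union by (intro lebesgue_integral_countable_add si) (auto simp: disjoint_family_on_def)
    with union show ?case by simp
  qed (simp add: set_lebesgue_integral_def)
qed

text \<open>Convexity of \<open>t powr p\<close> puts the tangent at \<open>a\<close> below the
  graph. The end point \<open>b = 0\<close> is treated separately: there the claim becomes
  \<open>(1 - p) * a powr p \<le> 0\<close>.\<close>

lemma powr_above_tangent: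
  fixes a b p :: real
  assumes "a > 0" "b \<ge> 0" "p \<ge> 1"
  shows "a powr p + p * a powr (p - 1) * (b - a) \<le> b powr p"
proof (cases "b = 0")
  case True
  have "a powr (p - 1) * a = a powr p"
    using assms by (simp add: powr_diff)
  then have "a powr p + p * a powr (p - 1) * (b - a) = (1 - p) * a powr p"
    using True by (simp add: algebra_simps)
  with assms True show ?thesis by (simp add: mult_nonpos_nonneg)
next
  case False
  have "p * a powr (p - 1) * (b - a) \<le> b powr p - a powr p"
    using assms False
    by (intro convex_on_imp_above_tangent[OF powr_convex[of p]])
       (auto intro!: derivative_eq_intros simp: interior_open)
  then show ?thesis by simp
qed

text \<open>The tangent inequality at the absolute value of the mean is integrated. A nonnegative
  integral on the right lets the bound hold for every measurable \<open>w\<close>: if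
  \<open>w\<close> is not integrable, its Bochner integral is 0 and so is the left side.\<close>

lemma (in finite_measure) Jensen_powr:
  fixes w :: "'a \<Rightarrow> real" and p :: real
  assumes [measurable]: "w \<in> borel_measurable M" and p: "p \<ge> 1"
    and m: "m = measure M (space M)" "m > 0"
  shows "ennreal (\<bar>(\<integral>x. w x \<partial>M) / m\<bar> powr p) * ennreal m \<le> (\<integral>\<^sup>+x. ennreal (\<bar>w x\<bar> powr p) \<partial>M)"
proof (cases "integrable M w \<and> (\<integral>x. w x \<partial>M) \<noteq> 0")
  case False
  then have "(\<integral>x. w x \<partial>M) = 0" using not_integrable_integral_eq by blast
  then show ?thesis by simp
next
  case True
  define a where "a = \<bar>(\<integral>x. w x \<partial>M) / m\<bar>"
  define c where "c = p * a powr (p - 1)"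
  have a: "a > 0" using True m by (simp add: a_def)
  have c: "c \<ge> 0" using p by (simp add: c_def)
  have em: "emeasure M (space M) = ennreal m" using m by (simp add: emeasure_eq_measure)
  have "(\<integral>\<^sup>+x. ennreal (a powr p) + ennreal c * ennreal \<bar>w x\<bar> \<partial>M)
      \<le> (\<integral>\<^sup>+x. ennreal (\<bar>w x\<bar> powr p) + ennreal (c * a) \<partial>M)"
  proof (rule nn_integral_mono)
    fix x
    have "a powr p + c * \<bar>w x\<bar> \<le> \<bar>w x\<bar> powr p + c * a"
      using powr_above_tangent[OF a abs_ge_zero p, of "w x"] by (simp add: c_def algebra_simps)
    then show "ennreal (a powr p) + ennreal c * ennreal \<bar>w x\<bar> \<le> ennreal (\<bar>w x\<bar> powr p) + ennreal (c * a)"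
      using a c by (simp flip: ennreal_plus ennreal_mult)
  qed
  then have *: "ennreal (a powr p) * ennreal m + ennreal c * (\<integral>\<^sup>+x. ennreal \<bar>w x\<bar> \<partial>M)
      \<le> (\<integral>\<^sup>+x. ennreal (\<bar>w x\<bar> powr p) \<partial>M) + ennreal (c * a) * ennreal m"
    by (simp add: nn_integral_add nn_integral_cmult em)
  have "ennreal (a * m) \<le> (\<integral>\<^sup>+x. ennreal \<bar>w x\<bar> \<partial>M)"
    using integral_norm_bound_ennreal[of M w] True m by (simp add: a_def)
  then have "ennreal c * ennreal (a * m) \<le> ennreal c * (\<integral>\<^sup>+x. ennreal \<bar>w x\<bar> \<partial>M)"
    by (rule mult_left_mono) simp
  then have "ennreal (a powr p) * ennreal m + ennreal c * ennreal (a * m)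
      \<le> (\<integral>\<^sup>+x. ennreal (\<bar>w x\<bar> powr p) \<partial>M) + ennreal (c * a) * ennreal m"
    using * by (meson add_left_mono order_trans)
  moreover have "ennreal (c * a) * ennreal m = ennreal c * ennreal (a * m)"
    using a c m by (simp flip: ennreal_mult add: mult.assoc)
  \<comment> \<open>Both sides share a finite term, which may therefore be cancelled in
    \<open>ennreal\<close>.\<close>
  ultimately have "ennreal c * ennreal (a * m) + ennreal (a powr p) * ennreal m
      \<le> ennreal c * ennreal (a * m) + (\<integral>\<^sup>+x. ennreal (\<bar>w x\<bar> powr p) \<partial>M)"
    by (simp add: add.commute)
  then show ?thesis
    by (simp add: ennreal_add_left_cancel_le ennreal_mult_eq_top_iff a_def)
qed

section \<open>Translations and differences along segments\<close>

lemma nn_integral_lborel_translate: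
  fixes f :: "'a::euclidean_space \<Rightarrow> ennreal"
  assumes [measurable]: "f \<in> borel_measurable borel"
  shows "(\<integral>\<^sup>+x. f (x + h) \<partial>lborel) = (\<integral>\<^sup>+x. f x \<partial>lborel)"
  by (subst (2) lborel_distr_plus[of h, symmetric]) (simp add: nn_integral_distr add.commute)

lemma
  fixes f :: "'a::euclidean_space \<Rightarrow> real"
  assumes [measurable]: "f \<in> borel_measurable borel"
  shows lborel_integral_translate: "(\<integral>x. f (x + h) \<partial>lborel) = (\<integral>x. f x \<partial>lborel)"
    and lborel_integrable_translate: "integrable lborel (\<lambda>x. f (x + h)) \<longleftrightarrow> integrable lborel f"
proof -
  show "(\<integral>x. f (x + h) \<partial>lborel) = (\<integral>x. f x \<partial>lborel)"
    by (subst (2) lborel_distr_plus[of h, symmetric]) (simp add: integral_distr add.commute)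
  show "integrable lborel (\<lambda>x. f (x + h)) \<longleftrightarrow> integrable lborel f"
    by (subst (2) lborel_distr_plus[of h, symmetric]) (simp add: integrable_distr_eq add.commute)
qed

lemma frechet_derivative_translate:
  fixes f :: "'a::euclidean_space \<Rightarrow> real"
  assumes "f \<in> bump_algebra"
  shows "frechet_derivative (\<lambda>x. f (x - c)) (at x) = frechet_derivative f (at (x - c))"
proof -
  have "((\<lambda>x. f (x - c)) has_derivative frechet_derivative f (at (x - c))) (at x)"
    by (rule has_derivative_compose[OF _ bump_algebra_has_derivative[OF assms]])
       (auto intro!: derivative_eq_intros)
  then show ?thesis by (metis frechet_derivative_at)
qed

text \<open>
  The weak gradient tested only against the bump algebra, with Borel representatives that are
  integrable over the whole space.
\<close>

locale weak_gradient =
  fixes B :: "'a::euclidean_space set" and U :: "'a \<Rightarrow> real" and G :: "'a \<Rightarrow> 'a \<Rightarrow> real"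
  assumes convex: "convex B" and open_B: "open B"
    and U: "integrable lborel U" and G: "\<And>i. i \<in> Basis \<Longrightarrow> integrable lborel (G i)"
    and weak: "\<And>i \<phi>. i \<in> Basis \<Longrightarrow> \<phi> \<in> bump_algebra \<Longrightarrow> compact (closure {x. \<phi> x \<noteq> 0}) \<Longrightarrow>
      closure {x. \<phi> x \<noteq> 0} \<subseteq> B \<Longrightarrow>
      (\<integral>x. U x * frechet_derivative \<phi> (at x) i \<partial>lborel) = - (\<integral>x. G i x * \<phi> x \<partial>lborel)"
begin

definition slope :: "'a \<Rightarrow> 'a \<Rightarrow> real" where
  "slope h x = (\<Sum>i\<in>Basis. (h \<bullet> i) * G i x)"

text \<open>The integrand is known to be integrable for almost every \<open>x\<close> only;
  elsewhere the Bochner integral may default to 0, and \<open>rise_powr_le\<close> still holds at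
  such points.\<close>

definition rise :: "'a \<Rightarrow> 'a \<Rightarrow> real" where
  "rise h x = (\<integral>t. indicator {0..1} t * slope h (x + t *\<^sub>R h) \<partial>lborel)"

lemma U_borel [measurable]: "U \<in> borel_measurable borel"
  using U by (simp add: borel_measurable_integrable)

lemma slope_integrable: "integrable lborel (slope h)"
  unfolding slope_def [abs_def] using G by auto

lemma slope_borel [measurable]: "slope h \<in> borel_measurable borel"
  using slope_integrable by (simp add: borel_measurable_integrable)

text \<open>By translation invariance the \<open>x\<close>-integral of the absolute value is the
  same for every \<open>t\<close> in the unit interval. This is why integrability is proved with
  \<open>t\<close> as the outer variable and the coordinates are swapped afterwards.\<close>

lemma slope_pair_integrable:
  "integrable (lborel \<Otimes>\<^sub>M lborel) (\<lambda>(x, t). indicator {0..1::real} t * slope h (x + t *\<^sub>R h))"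
proof -
  have "integrable (lborel \<Otimes>\<^sub>M lborel) (\<lambda>(t, x). indicator {0..1::real} t * slope h (x + t *\<^sub>R h))"
  proof (rule lborel_pair.Fubini_integrable)
    have "(\<integral>x. norm (indicator {0..1::real} t * slope h (x + t *\<^sub>R h)) \<partial>lborel)
        = indicator {0..1} t * (\<integral>x. \<bar>slope h x\<bar> \<partial>lborel)" for t
      using lborel_integral_translate[of "\<lambda>x. \<bar>slope h x\<bar>" "t *\<^sub>R h"] by (simp add: abs_mult)
    moreover have "integrable lborel (\<lambda>t. indicator {0..1::real} t * (\<integral>x. \<bar>slope h x\<bar> \<partial>lborel))"
      by (intro integrable_mult_left) simp
    ultimately show "integrable lborel
        (\<lambda>t. \<integral>x. norm ((\<lambda>(t, x). indicator {0..1::real} t * slope h (x + t *\<^sub>R h)) (t, x)) \<partial>lborel)"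
      by simp
    show "AE t in lborel. integrable lborel
        (\<lambda>x. (\<lambda>(t, x). indicator {0..1::real} t * slope h (x + t *\<^sub>R h)) (t, x))"
      by (auto simp: lborel_integrable_translate slope_integrable)
  qed measurable
  from lborel_pair.integrable_product_swap[OF this] show ?thesis
    by (simp add: case_prod_unfold)
qed

lemma rise_integrable: "integrable lborel (rise h)"
  unfolding rise_def [abs_def] by (rule lborel_pair.integrable_fst[OF slope_pair_integrable])

text \<open>The translation of \<open>U\<close> is moved onto the test function, and
  \<open>\<phi> (x - h) - \<phi> x\<close> is minus the integral over \<open>t\<close> of the
  derivative along \<open>h\<close> at \<open>x - t *\<^sub>R h\<close>. Fubini's theorem puts
  \<open>t\<close> outside, where the weak gradient applies to each translate of
  \<open>\<phi>\<close>, and a second use puts \<open>t\<close> back inside. The two support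
  conditions together with convexity keep every translate supported in \<open>B\<close>.\<close>

lemma rise_test:
  assumes \<phi>: "\<phi> \<in> bump_algebra" and comp: "compact (closure {x. \<phi> x \<noteq> 0})"
    and supp: "closure {x. \<phi> x \<noteq> 0} \<subseteq> B" "\<And>x. x \<in> closure {x. \<phi> x \<noteq> 0} \<Longrightarrow> x + h \<in> B"
  shows "(\<integral>x. (U (x + h) - U x) * \<phi> x \<partial>lborel) = (\<integral>x. rise h x * \<phi> x \<partial>lborel)"
proof -
  have [measurable]: "f \<in> borel_measurable borel" if "f \<in> bump_algebra" for f :: "'a \<Rightarrow> real"
    using that by (intro borel_measurable_continuous_onI bump_algebra_continuous)
  define D where "D i x = frechet_derivative \<phi> (at x) i" for i x
  have D: "D i \<in> bump_algebra" for i
    unfolding D_def [abs_def] by (rule bump_algebra_frechet_derivative[OF \<phi>])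
  have [measurable]: "\<phi> \<in> borel_measurable borel" "D i \<in> borel_measurable borel" for i
    using \<phi> D by auto
  \<comment> \<open>The weak gradient is given in basis directions only.\<close>
  have D_sum: "D h x = (\<Sum>i\<in>Basis. (h \<bullet> i) * D i x)" for x
  proof -
    have lin: "linear (frechet_derivative \<phi> (at x))"
      using bump_algebra_has_derivative[OF \<phi>] by (rule has_derivative_linear)
    have "D h x = frechet_derivative \<phi> (at x) (\<Sum>i\<in>Basis. (h \<bullet> i) *\<^sub>R i)"
      by (simp add: D_def euclidean_representation)
    also have "\<dots> = (\<Sum>i\<in>Basis. (h \<bullet> i) * D i x)"
      by (simp add: linear_sum[OF lin] linear_scale[OF lin] D_def)
    finally show ?thesis .
  qed
  have bdd: "\<exists>M. \<forall>x. \<bar>f x\<bar> \<le> M" if "f \<in> bump_algebra" for f :: "'a \<Rightarrow> real"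
    using that by (rule bump_algebra_bounded)
  have int_bdd: "integrable lborel (\<lambda>x. f x * g x)"
    if f: "integrable lborel f" and g: "g \<in> bump_algebra" for f g :: "'a \<Rightarrow> real"
  proof -
    obtain M where M: "\<And>x. \<bar>g x\<bar> \<le> M" using bdd[OF g] by blast
    show ?thesis
    proof (rule Bochner_Integration.integrable_bound[of _ "\<lambda>x. M * f x"])
      show "AE x in lborel. norm (f x * g x) \<le> norm (M * f x)"
        using M by (auto simp: abs_mult mult.commute[of M] intro!: mult_left_mono order_trans[OF M])
    qed (use f g in \<open>auto intro!: borel_measurable_times borel_measurable_integrable\<close>)
  qed
  \<comment> \<open>The primitive in \<open>t\<close> is
    \<open>- \<phi> (x - t *\<^sub>R h)\<close>, whence the sign.\<close>
  have FTC: "(\<integral>t. D h (x - t *\<^sub>R h) * indicator {0..1} t \<partial>lborel) = - (\<phi> (x - h) - \<phi> x)" for x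
  proof -
    have "(\<integral>t. D h (x - t *\<^sub>R h) * indicator {0..1} t \<partial>lborel)
        = - \<phi> (x - 1 *\<^sub>R h) - (- \<phi> (x - 0 *\<^sub>R h))"
    proof (rule integral_FTC_Icc_real)
      fix t :: real
      have "((\<lambda>t. \<phi> (x - t *\<^sub>R h)) has_derivative
          (\<lambda>s. frechet_derivative \<phi> (at (x - t *\<^sub>R h)) (- (s *\<^sub>R h)))) (at t)"
        by (rule has_derivative_compose[OF _ bump_algebra_has_derivative[OF \<phi>]])
           (auto intro!: derivative_eq_intros)
      moreover have "linear (frechet_derivative \<phi> (at (x - t *\<^sub>R h)))"
        using bump_algebra_has_derivative[OF \<phi>] by (rule has_derivative_linear)
      ultimately have "((\<lambda>t. \<phi> (x - t *\<^sub>R h)) has_derivative (\<lambda>s. - D h (x - t *\<^sub>R h) * s)) (at t)"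
        by (simp add: linear_neg linear_scale D_def mult.commute)
      then have "((\<lambda>t. \<phi> (x - t *\<^sub>R h)) has_real_derivative - D h (x - t *\<^sub>R h)) (at t)"
        unfolding has_field_derivative_def .
      from DERIV_minus[OF this]
      show "((\<lambda>t. - \<phi> (x - t *\<^sub>R h)) has_real_derivative D h (x - t *\<^sub>R h)) (at t)" by simp
      have "continuous_on UNIV (\<lambda>t. D h (x - t *\<^sub>R h))"
        by (rule continuous_on_compose2[OF bump_algebra_continuous[OF D, of UNIV]])
           (auto intro!: continuous_intros)
      then show "isCont (\<lambda>t. D h (x - t *\<^sub>R h)) t" by (simp add: continuous_on_eq_continuous_at)
    qed simp
    then show ?thesis by simp
  qed
  have pair1: "integrable (lborel \<Otimes>\<^sub>M lborel)
      (\<lambda>(x, t). U x * (D h (x - t *\<^sub>R h) * indicator {0..1::real} t))"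
  proof -
    obtain M where M: "\<And>x. \<bar>D h x\<bar> \<le> M" using bdd[OF D] by blast
    have "integrable (lborel \<Otimes>\<^sub>M lborel) (\<lambda>(x, t). (M * U x) * indicator {0..1::real} t)"
    proof (rule lborel_pair.Fubini_integrable)
      have "integrable lborel (\<lambda>x. \<bar>M * U x\<bar>)" using U by simp
      then show "integrable lborel
        (\<lambda>x. \<integral>t. norm ((\<lambda>(x, t). (M * U x) * indicator {0..1::real} t) (x, t)) \<partial>lborel)"
        by (simp add: abs_mult)
    qed (use U in \<open>auto\<close>)
    then show ?thesis
    proof (rule Bochner_Integration.integrable_bound)
      show "AE z in lborel \<Otimes>\<^sub>M lborel. norm (case z of (x, t) \<Rightarrow> U x * (D h (x - t *\<^sub>R h) * indicator {0..1::real} t))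
          \<le> norm (case z of (x, t) \<Rightarrow> M * U x * indicator {0..1::real} t)"
        using M by (intro AE_I2) (auto simp: abs_mult indicator_def mult.commute[of _ "\<bar>U _\<bar>"]
            intro!: mult_left_mono order_trans[OF M])
    qed measurable
  qed
  have pair2: "integrable (lborel \<Otimes>\<^sub>M lborel)
      (\<lambda>(x, t). indicator {0..1::real} t * slope h (x + t *\<^sub>R h) * \<phi> x)"
  proof -
    obtain M where M: "\<And>x. \<bar>\<phi> x\<bar> \<le> M" using bdd[OF \<phi>] by blast
    have "integrable (lborel \<Otimes>\<^sub>M lborel)
        (\<lambda>z. M * (case z of (x, t) \<Rightarrow> indicator {0..1::real} t * slope h (x + t *\<^sub>R h)))"
      using slope_pair_integrable by (rule integrable_mult_right)
    then show ?thesis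
    proof (rule Bochner_Integration.integrable_bound)
      show "AE z in lborel \<Otimes>\<^sub>M lborel.
          norm (case z of (x, t) \<Rightarrow> indicator {0..1::real} t * slope h (x + t *\<^sub>R h) * \<phi> x)
          \<le> norm (M * (case z of (x, t) \<Rightarrow> indicator {0..1::real} t * slope h (x + t *\<^sub>R h)))"
        using M by (intro AE_I2) (auto simp: abs_mult indicator_def mult.commute[of M] mult.commute[of "\<bar>M\<bar>"]
            intro!: mult_left_mono order_trans[OF M])
    qed measurable
  qed
  have inner: "(\<integral>x. U x * D h (x - t *\<^sub>R h) \<partial>lborel) = - (\<integral>x. slope h (x + t *\<^sub>R h) * \<phi> x \<partial>lborel)"
    if t: "t \<in> {0..1}" for t :: real
  proof -
    define \<psi> where "\<psi> x = \<phi> (x - t *\<^sub>R h)" for x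
    have \<psi>: "\<psi> \<in> bump_algebra"
      unfolding \<psi>_def [abs_def] using \<phi> by (rule bump_algebra_translate)
    have "{x. \<psi> x \<noteq> 0} = (\<lambda>x. t *\<^sub>R h + x) ` {x. \<phi> x \<noteq> 0}"
      by (auto simp: \<psi>_def image_iff intro!: exI[of _ "_ - t *\<^sub>R h"])
    then have cl: "closure {x. \<psi> x \<noteq> 0} = (\<lambda>x. t *\<^sub>R h + x) ` closure {x. \<phi> x \<noteq> 0}"
      by (simp add: closure_translation)
    have "closure {x. \<psi> x \<noteq> 0} \<subseteq> B"
    proof
      fix y assume "y \<in> closure {x. \<psi> x \<noteq> 0}"
      then obtain x where x: "x \<in> closure {x. \<phi> x \<noteq> 0}" "y = t *\<^sub>R h + x" unfolding cl by auto
      have "(1 - t) *\<^sub>R x + t *\<^sub>R (x + h) \<in> B"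
        using t x supp by (intro convexD_alt[OF convex]) auto
      then show "y \<in> B" by (simp add: x(2) algebra_simps)
    qed
    moreover have "compact (closure {x. \<psi> x \<noteq> 0})"
      unfolding cl using comp by (rule compact_translation)
    ultimately have *: "(\<integral>x. U x * D i (x - t *\<^sub>R h) \<partial>lborel) = - (\<integral>x. G i x * \<psi> x \<partial>lborel)"
      if "i \<in> Basis" for i
      using weak[OF that \<psi>] frechet_derivative_translate[OF \<phi>, of "t *\<^sub>R h"]
      by (simp add: D_def \<psi>_def [abs_def])
    have "(\<integral>x. U x * D h (x - t *\<^sub>R h) \<partial>lborel)
        = (\<integral>x. (\<Sum>i\<in>Basis. (h \<bullet> i) * (U x * D i (x - t *\<^sub>R h))) \<partial>lborel)"
      by (simp add: D_sum sum_distrib_left mult.left_commute)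
    also have "\<dots> = (\<Sum>i\<in>Basis. (h \<bullet> i) * (\<integral>x. U x * D i (x - t *\<^sub>R h) \<partial>lborel))"
      by (subst Bochner_Integration.integral_sum)
         (auto intro!: integrable_mult_right int_bdd U bump_algebra_translate D)
    also have "\<dots> = - (\<Sum>i\<in>Basis. (h \<bullet> i) * (\<integral>x. G i x * \<psi> x \<partial>lborel))"
      by (simp add: * sum_negf)
    also have "(\<Sum>i\<in>Basis. (h \<bullet> i) * (\<integral>x. G i x * \<psi> x \<partial>lborel))
        = (\<integral>x. (\<Sum>i\<in>Basis. (h \<bullet> i) * (G i x * \<psi> x)) \<partial>lborel)"
      by (subst Bochner_Integration.integral_sum)
         (auto intro!: integrable_mult_right int_bdd G \<psi>)
    also have "\<dots> = (\<integral>x. slope h x * \<psi> x \<partial>lborel)"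
      by (simp add: slope_def sum_distrib_right mult.assoc)
    also have "\<dots> = (\<integral>x. slope h (x + t *\<^sub>R h) * \<psi> (x + t *\<^sub>R h) \<partial>lborel)"
      using \<psi> by (intro lborel_integral_translate[symmetric]) measurable
    finally show ?thesis by (simp add: \<psi>_def)
  qed
  have "(\<integral>x. (U (x + h) - U x) * \<phi> x \<partial>lborel)
      = (\<integral>x. U (x + h) * \<phi> x \<partial>lborel) - (\<integral>x. U x * \<phi> x \<partial>lborel)"
    by (subst Bochner_Integration.integral_diff [symmetric])
       (auto intro!: int_bdd \<phi> U simp: lborel_integrable_translate left_diff_distrib)
  also have "(\<integral>x. U (x + h) * \<phi> x \<partial>lborel) = (\<integral>x. U x * \<phi> (x - h) \<partial>lborel)"
    using lborel_integral_translate[of "\<lambda>x. U x * \<phi> (x - h)" h] by simp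
  also have "\<dots> - (\<integral>x. U x * \<phi> x \<partial>lborel) = (\<integral>x. U x * (\<phi> (x - h) - \<phi> x) \<partial>lborel)"
    by (subst Bochner_Integration.integral_diff [symmetric])
       (auto intro!: int_bdd \<phi> U bump_algebra_translate simp: right_diff_distrib)
  also have "\<dots> = - (\<integral>x. U x * (\<integral>t. D h (x - t *\<^sub>R h) * indicator {0..1} t \<partial>lborel) \<partial>lborel)"
    unfolding FTC by (simp add: algebra_simps flip: integral_minus)
  also have "\<dots> = - (\<integral>x. (\<integral>t. U x * (D h (x - t *\<^sub>R h) * indicator {0..1} t) \<partial>lborel) \<partial>lborel)"
    by simp
  also have "\<dots> = - (\<integral>t. (\<integral>x. U x * (D h (x - t *\<^sub>R h) * indicator {0..1} t) \<partial>lborel) \<partial>lborel)"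
    by (subst lborel_pair.Fubini_integral[OF pair1]) simp
  also have "\<dots> = (\<integral>t. - ((\<integral>x. U x * D h (x - t *\<^sub>R h) \<partial>lborel) * indicator {0..1} t) \<partial>lborel)"
    by (simp add: mult.assoc[symmetric])
  also have "\<dots> = (\<integral>t. indicator {0..1} t * (\<integral>x. slope h (x + t *\<^sub>R h) * \<phi> x \<partial>lborel) \<partial>lborel)"
    by (intro Bochner_Integration.integral_cong) (auto simp: indicator_def inner)
  also have "\<dots> = (\<integral>t. (\<integral>x. indicator {0..1} t * slope h (x + t *\<^sub>R h) * \<phi> x \<partial>lborel) \<partial>lborel)"
    by (simp add: mult.assoc)
  also have "\<dots> = (\<integral>x. (\<integral>t. indicator {0..1} t * slope h (x + t *\<^sub>R h) * \<phi> x \<partial>lborel) \<partial>lborel)"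
    by (rule lborel_pair.Fubini_integral[OF pair2])
  also have "\<dots> = (\<integral>x. rise h x * \<phi> x \<partial>lborel)"
    by (simp add: rise_def)
  finally show ?thesis .
qed

text \<open>The points with both ends in \<open>B\<close> form an open set, hence a countable union
  of boxes; inside it the bumps turn \<open>rise_test\<close> into vanishing integrals of the
  discrepancy \<open>v\<close> over all boxes.\<close>

lemma AE_rise:
  "AE x in lborel. x \<in> B \<longrightarrow> x + h \<in> B \<longrightarrow> U (x + h) - U x = rise h x"
proof -
  define W where "W = B \<inter> (\<lambda>x. x + h) -` B"
  have "open W"
    unfolding W_def by (intro open_Int open_B open_vimage continuous_intros)
  then obtain \<D> where \<D>: "countable \<D>" "\<D> \<subseteq> Pow W" "\<And>X. X \<in> \<D> \<Longrightarrow> \<exists>a b. X = box a b" "\<Union>\<D> = W"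
    by (rule open_countable_Union_open_box) blast
  define v where "v x = U (x + h) - U x - rise h x" for x
  have v: "integrable lborel v"
    unfolding v_def [abs_def]
    by (intro Bochner_Integration.integrable_diff rise_integrable U)
       (simp add: lborel_integrable_translate U)
  have zero: "(LINT x:box a b|lborel. v x) = 0" if sub: "box a b \<subseteq> W" for a b
  proof -
    obtain \<phi> :: "nat \<Rightarrow> 'a \<Rightarrow> real" where \<phi>: "\<And>n. \<phi> n \<in> bump_algebra"
      "\<And>n. compact (closure {x. \<phi> n x \<noteq> 0})"
      "\<And>n. closure {x. \<phi> n x \<noteq> 0} \<subseteq> box a b"
      "\<And>n x. \<bar>\<phi> n x\<bar> \<le> 1"
      "\<And>x. (\<lambda>n. \<phi> n x) \<longlonglongrightarrow> indicator (box a b) x"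
      using box_bumps[of a b] by blast
    have [measurable]: "\<phi> n \<in> borel_measurable borel" for n
      by (intro borel_measurable_continuous_onI bump_algebra_continuous \<phi>)
    have int: "integrable lborel (\<lambda>x. f x * \<phi> n x)" if "integrable lborel f" for f n
      by (rule Bochner_Integration.integrable_bound[OF that])
         (use that \<phi>(4) in \<open>auto simp: abs_mult intro!: mult_left_le borel_measurable_times borel_measurable_integrable\<close>)
    have "(\<integral>x. v x * \<phi> n x \<partial>lborel) = 0" for n
    proof -
      have "(\<integral>x. v x * \<phi> n x \<partial>lborel)
          = (\<integral>x. (U (x + h) - U x) * \<phi> n x \<partial>lborel) - (\<integral>x. rise h x * \<phi> n x \<partial>lborel)"
        by (subst Bochner_Integration.integral_diff [symmetric])
           (auto intro!: int Bochner_Integration.integrable_diff rise_integrable U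
             simp: lborel_integrable_translate v_def left_diff_distrib)
      also have "\<dots> = 0"
        using rise_test[OF \<phi>(1,2), of n h] \<phi>(3)[of n] sub by (auto simp: W_def)
      finally show ?thesis .
    qed
    moreover have "(\<lambda>n. \<integral>x. v x * \<phi> n x \<partial>lborel) \<longlonglongrightarrow> (\<integral>x. v x * indicator (box a b) x \<partial>lborel)"
    proof (rule integral_dominated_convergence[where w = "\<lambda>x. \<bar>v x\<bar>"])
      show "AE x in lborel. (\<lambda>n. v x * \<phi> n x) \<longlonglongrightarrow> v x * indicator (box a b) x"
        by (intro AE_I2 tendsto_mult tendsto_const \<phi>)
      show "AE x in lborel. norm (v x * \<phi> n x) \<le> \<bar>v x\<bar>" for n
        using \<phi>(4) by (auto simp: abs_mult intro!: mult_left_le)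
    qed (use v in \<open>auto intro!: borel_measurable_times borel_measurable_integrable\<close>)
    ultimately have "(\<lambda>n. 0) \<longlonglongrightarrow> (\<integral>x. v x * indicator (box a b) x \<partial>lborel)"
      by simp
    then have "(\<integral>x. v x * indicator (box a b) x \<partial>lborel) = 0"
      by (rule LIMSEQ_unique) (rule tendsto_const)
    then show ?thesis
      by (simp add: set_lebesgue_integral_def mult.commute)
  qed
  have "AE x in lborel. x \<in> X \<longrightarrow> v x = 0" if X_mem: "X \<in> \<D>" for X
  proof -
    obtain a b where X: "X = box a b" using \<D>(3)[OF X_mem] by blast
    \<comment> \<open>Cutting off at \<open>X\<close> makes the box criterion on the whole space
      applicable: every box meets \<open>X\<close> in a box contained in \<open>W\<close>.\<close>
    have "AE x in lborel. indicator X x * v x = 0"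
    proof (rule AE_zero_of_box_integrals)
      show "integrable lborel (\<lambda>x. indicator X x * v x)"
        using integrable_mult_indicator[OF _ v, of X] by (simp add: X)
      fix c d
      obtain e f where ef: "box c d \<inter> X = box e f" unfolding X box_Int_box by blast
      have "(LINT x:box c d|lborel. indicator X x * v x) = (LINT x:box c d \<inter> X|lborel. v x)"
        by (simp add: set_lebesgue_integral_def indicator_inter_arith mult.assoc)
      also have "\<dots> = 0"
        unfolding ef using \<D>(2) X_mem ef by (intro zero) auto
      finally show "(LINT x:box c d|lborel. indicator X x * v x) = 0" .
    qed
    then show ?thesis by eventually_elim auto
  qed
  then have "AE x in lborel. \<forall>X\<in>\<D>. x \<in> X \<longrightarrow> v x = 0"
    using \<D>(1) by (subst AE_ball_countable) auto
  then show ?thesis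
    by eventually_elim (use \<D>(4) in \<open>auto simp: W_def v_def\<close>)
qed

lemma abs_slope_le: "\<bar>slope h x\<bar> \<le> norm h * (\<Sum>i\<in>Basis. \<bar>G i x\<bar>)"
proof -
  have "\<bar>slope h x\<bar> \<le> (\<Sum>i\<in>Basis. \<bar>(h \<bullet> i) * G i x\<bar>)"
    unfolding slope_def by (rule sum_abs)
  also have "\<dots> \<le> (\<Sum>i\<in>Basis. norm h * \<bar>G i x\<bar>)"
    by (intro sum_mono) (auto simp: abs_mult Basis_le_norm intro!: mult_right_mono)
  finally show ?thesis by (simp add: sum_distrib_left)
qed

lemma rise_powr_le:
  assumes "p \<ge> 1"
  shows "ennreal (\<bar>rise h x\<bar> powr p)
    \<le> (\<integral>\<^sup>+t. ennreal (\<bar>slope h (x + t *\<^sub>R h)\<bar> powr p) * indicator {0..1} t \<partial>lborel)"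
proof -
  let ?M = "restrict_space lborel {0..1::real}"
  interpret finite_measure ?M
    by (rule finite_measureI) (simp add: emeasure_restrict_space space_restrict_space)
  have "ennreal (\<bar>(\<integral>t. slope h (x + t *\<^sub>R h) \<partial>?M) / 1\<bar> powr p) * ennreal 1
      \<le> (\<integral>\<^sup>+t. ennreal (\<bar>slope h (x + t *\<^sub>R h)\<bar> powr p) \<partial>?M)"
    by (rule Jensen_powr)
       (use assms in \<open>auto simp: measure_restrict_space space_restrict_space intro!: measurable_restrict_space1\<close>)
  then show ?thesis
    by (simp add: integral_restrict_space nn_integral_restrict_space rise_def)
qed

text \<open>Jensen's inequality on the segment bounds the difference at \<open>x\<close> by an
  integral over \<open>t\<close>. After the order is exchanged, the shift by
  \<open>t *\<^sub>R h\<close> disappears by translation invariance, so every \<open>t\<close>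
  contributes the same amount.\<close>

lemma translation_estimate:
  assumes p: "p \<ge> 1"
  shows "(\<integral>\<^sup>+x. ennreal (\<bar>U (x + h) - U x\<bar> powr p) * indicator B x * indicator B (x + h) \<partial>lborel)
    \<le> ennreal (norm h powr p) * (\<integral>\<^sup>+x. ennreal ((\<Sum>i\<in>Basis. \<bar>G i x\<bar>) powr p) * indicator B x \<partial>lborel)"
proof -
  have [measurable]: "B \<in> sets borel" using open_B by simp
  have [measurable]: "i \<in> Basis \<Longrightarrow> G i \<in> borel_measurable borel" for i
    using G by (simp add: borel_measurable_integrable)
  \<comment> \<open>Convexity keeps the segment in \<open>B\<close>, so the cut-off can sit at the
    intermediate point and the final integral extends over \<open>B\<close> alone.\<close>
  define \<gamma> where "\<gamma> x = ennreal ((\<Sum>i\<in>Basis. \<bar>G i x\<bar>) powr p) * indicator B x" for x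
  have [measurable]: "\<gamma> \<in> borel_measurable borel"
    unfolding \<gamma>_def [abs_def] by measurable
  have "(\<integral>\<^sup>+x. ennreal (\<bar>U (x + h) - U x\<bar> powr p) * indicator B x * indicator B (x + h) \<partial>lborel)
      \<le> (\<integral>\<^sup>+x. (\<integral>\<^sup>+t. ennreal (norm h powr p) * \<gamma> (x + t *\<^sub>R h) * indicator {0..1} t \<partial>lborel) \<partial>lborel)"
  proof (rule nn_integral_mono_AE, use AE_rise[of h] in eventually_elim)
    fix x assume rise: "x \<in> B \<longrightarrow> x + h \<in> B \<longrightarrow> U (x + h) - U x = rise h x"
    show "ennreal (\<bar>U (x + h) - U x\<bar> powr p) * indicator B x * indicator B (x + h)
        \<le> (\<integral>\<^sup>+t. ennreal (norm h powr p) * \<gamma> (x + t *\<^sub>R h) * indicator {0..1} t \<partial>lborel)"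
    proof (cases "x \<in> B \<and> x + h \<in> B")
      case True
      have "ennreal (\<bar>rise h x\<bar> powr p)
          \<le> (\<integral>\<^sup>+t. ennreal (\<bar>slope h (x + t *\<^sub>R h)\<bar> powr p) * indicator {0..1} t \<partial>lborel)"
        by (rule rise_powr_le[OF p])
      also have "\<dots> \<le> (\<integral>\<^sup>+t. ennreal (norm h powr p) * \<gamma> (x + t *\<^sub>R h) * indicator {0..1} t \<partial>lborel)"
      proof (rule nn_integral_mono)
        fix t :: real
        show "ennreal (\<bar>slope h (x + t *\<^sub>R h)\<bar> powr p) * indicator {0..1} t
            \<le> ennreal (norm h powr p) * \<gamma> (x + t *\<^sub>R h) * indicator {0..1} t"
        proof (cases "t \<in> {0..1}")
          case t: True
          have "(1 - t) *\<^sub>R x + t *\<^sub>R (x + h) \<in> B"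
            using t True by (intro convexD_alt[OF convex]) auto
          then have "x + t *\<^sub>R h \<in> B" by (simp add: algebra_simps)
          moreover have "\<bar>slope h (x + t *\<^sub>R h)\<bar> powr p
              \<le> (norm h * (\<Sum>i\<in>Basis. \<bar>G i (x + t *\<^sub>R h)\<bar>)) powr p"
            using p by (intro powr_mono2 abs_slope_le) auto
          ultimately show ?thesis
            using t by (simp add: \<gamma>_def powr_mult sum_nonneg flip: ennreal_mult)
        qed simp
      qed
      finally show ?thesis using True rise by simp
    qed auto
  qed
  also have "\<dots> = (\<integral>\<^sup>+t. (\<integral>\<^sup>+x. ennreal (norm h powr p) * \<gamma> (x + t *\<^sub>R h) * indicator {0..1::real} t \<partial>lborel) \<partial>lborel)"
    by (rule lborel_pair.Fubini') measurable
  also have "\<dots> = (\<integral>\<^sup>+t. ennreal (norm h powr p) * (\<integral>\<^sup>+x. \<gamma> x \<partial>lborel) * indicator {0..1::real} t \<partial>lborel)"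
    by (simp add: nn_integral_cmult nn_integral_multc nn_integral_lborel_translate)
  also have "\<dots> = ennreal (norm h powr p) * (\<integral>\<^sup>+x. \<gamma> x \<partial>lborel)"
    by (simp add: nn_integral_cmult_indicator)
  finally show ?thesis by (simp add: \<gamma>_def)
qed

end

text \<open>
  The translation estimate is averaged over all differences \<open>h = y - x\<close> of points of the ball,
  none of which exceeds the diameter.
\<close>

lemma Poincare_ball:
  fixes U :: "'a::euclidean_space \<Rightarrow> real"
  assumes "weak_gradient (ball z r) U G" and r: "r > 0" and p: "p \<ge> 1"
  defines "B \<equiv> ball z r"
  shows "(\<integral>\<^sup>+x. ennreal (\<bar>U x - (\<integral>y. indicator B y * U y \<partial>lborel) / measure lborel B\<bar> powr p)
      * indicator B x \<partial>lborel)
    \<le> ennreal (2 ^ DIM('a) * (2 * r) powr p)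
      * (\<integral>\<^sup>+x. ennreal ((\<Sum>i\<in>Basis. \<bar>G i x\<bar>) powr p) * indicator B x \<partial>lborel)"
proof -
  interpret weak_gradient B U G using assms by simp
  have [measurable]: "B \<in> sets borel" by (simp add: B_def)
  have [measurable]: "i \<in> Basis \<Longrightarrow> G i \<in> borel_measurable borel" for i
    using G by (simp add: borel_measurable_integrable)
  define m where "m = measure lborel B"
  define a where "a = (\<integral>y. indicator B y * U y \<partial>lborel) / m"
  define E where "E = (\<integral>\<^sup>+x. ennreal ((\<Sum>i\<in>Basis. \<bar>G i x\<bar>) powr p) * indicator B x \<partial>lborel)"
  have m: "m = unit_ball_vol DIM('a) * r ^ DIM('a)" "m > 0"
    using r by (auto simp: m_def B_def content_ball)
  have emB: "emeasure lborel B = ennreal m"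
    using r by (simp add: B_def emeasure_ball m)
  let ?M = "restrict_space lborel B"
  interpret M: finite_measure ?M
    by (rule finite_measureI) (simp add: emeasure_restrict_space space_restrict_space emB)
  have UB: "integrable ?M U"
    using integrable_mult_indicator[OF _ U, of B] by (simp add: integrable_restrict_space)
  have mM: "measure ?M (space ?M) = m"
    by (simp add: measure_restrict_space space_restrict_space m_def)
  \<comment> \<open>\<open>a - U x\<close> is the mean of \<open>U y - U x\<close> over
    \<open>y\<close> in \<open>B\<close>.\<close>
  have Jensen: "ennreal (\<bar>U x - a\<bar> powr p) * ennreal m
      \<le> (\<integral>\<^sup>+y. ennreal (\<bar>U y - U x\<bar> powr p) * indicator B y \<partial>lborel)" for x
  proof -
    have "ennreal (\<bar>(\<integral>y. U y - U x \<partial>?M) / m\<bar> powr p) * ennreal m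
      \<le> (\<integral>\<^sup>+y. ennreal (\<bar>U y - U x\<bar> powr p) \<partial>?M)"
      by (rule M.Jensen_powr[OF _ p mM[symmetric] m(2)]) (auto intro!: measurable_restrict_space1)
    moreover have "(\<integral>y. U y - U x \<partial>?M) / m = a - U x"
      using m(2) mM by (simp add: UB space_restrict_space integral_restrict_space[of B lborel U] a_def diff_divide_distrib)
    ultimately show ?thesis
      by (simp add: nn_integral_restrict_space abs_minus_commute)
  qed
  have "(\<integral>\<^sup>+x. ennreal (\<bar>U x - a\<bar> powr p) * indicator B x \<partial>lborel) * ennreal m
      = (\<integral>\<^sup>+x. ennreal (\<bar>U x - a\<bar> powr p) * ennreal m * indicator B x \<partial>lborel)"
    by (subst nn_integral_multc [symmetric]) (auto simp: mult.assoc mult.commute[of "indicator B _"])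
  also have "\<dots> \<le> (\<integral>\<^sup>+x. (\<integral>\<^sup>+y. ennreal (\<bar>U y - U x\<bar> powr p) * indicator B y \<partial>lborel) * indicator B x \<partial>lborel)"
    by (intro nn_integral_mono mult_right_mono Jensen) auto
  also have "\<dots> = (\<integral>\<^sup>+x. (\<integral>\<^sup>+h. ennreal (\<bar>U (x + h) - U x\<bar> powr p) * indicator B x * indicator B (x + h) \<partial>lborel) \<partial>lborel)"
  proof (rule nn_integral_cong)
    fix x
    have "(\<integral>\<^sup>+y. ennreal (\<bar>U y - U x\<bar> powr p) * indicator B y \<partial>lborel)
        = (\<integral>\<^sup>+h. ennreal (\<bar>U (h + x) - U x\<bar> powr p) * indicator B (h + x) \<partial>lborel)"
      by (rule nn_integral_lborel_translate[symmetric]) measurable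
    then show "(\<integral>\<^sup>+y. ennreal (\<bar>U y - U x\<bar> powr p) * indicator B y \<partial>lborel) * indicator B x
        = (\<integral>\<^sup>+h. ennreal (\<bar>U (x + h) - U x\<bar> powr p) * indicator B x * indicator B (x + h) \<partial>lborel)"
      by (cases "x \<in> B") (auto simp: add.commute)
  qed
  also have "\<dots> = (\<integral>\<^sup>+h. (\<integral>\<^sup>+x. ennreal (\<bar>U (x + h) - U x\<bar> powr p) * indicator B x * indicator B (x + h) \<partial>lborel) \<partial>lborel)"
    by (rule lborel_pair.Fubini') measurable
  also have "\<dots> \<le> (\<integral>\<^sup>+h. ennreal ((2 * r) powr p) * E * indicator (ball (0::'a) (2 * r)) h \<partial>lborel)"
  proof (rule nn_integral_mono)
    fix h :: 'a
    show "(\<integral>\<^sup>+x. ennreal (\<bar>U (x + h) - U x\<bar> powr p) * indicator B x * indicator B (x + h) \<partial>lborel)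
        \<le> ennreal ((2 * r) powr p) * E * indicator (ball 0 (2 * r)) h"
    proof (cases "norm h < 2 * r")
      case True
      have "(\<integral>\<^sup>+x. ennreal (\<bar>U (x + h) - U x\<bar> powr p) * indicator B x * indicator B (x + h) \<partial>lborel)
          \<le> ennreal (norm h powr p) * E"
        unfolding E_def by (rule translation_estimate[OF p])
      also have "\<dots> \<le> ennreal ((2 * r) powr p) * E"
        using True p by (intro mult_right_mono ennreal_leI powr_mono2) auto
      finally show ?thesis using True by simp
    next
      case False
      have "\<not> (x \<in> B \<and> x + h \<in> B)" for x
      proof
        assume "x \<in> B \<and> x + h \<in> B"
        then have "dist z x + dist z (x + h) < 2 * r" by (simp add: B_def)
        moreover have "norm h \<le> dist z x + dist z (x + h)"
          using dist_triangle[of x "x + h" z] by (simp add: dist_norm norm_minus_commute)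
        ultimately show False using False by simp
      qed
      then have "(\<integral>\<^sup>+x. ennreal (\<bar>U (x + h) - U x\<bar> powr p) * indicator B x * indicator B (x + h) \<partial>lborel) = 0"
        by (subst nn_integral_0_iff_AE) (auto simp: indicator_def)
      then show ?thesis by simp
    qed
  qed
  \<comment> \<open>The ball of admissible \<open>h\<close> has twice the radius of
    \<open>B\<close>, hence \<open>2 ^ DIM('a)\<close> times its volume; the factor \<open>m\<close>
    cancels the one from Jensen's inequality.\<close>
  also have "\<dots> = ennreal ((2 * r) powr p) * E * ennreal (2 ^ DIM('a) * m)"
    using r by (subst nn_integral_cmult_indicator) (auto simp: emeasure_ball m power_mult_distrib mult_ac)
  also have "\<dots> = ennreal (2 ^ DIM('a) * (2 * r) powr p) * E * ennreal m"
    using m(2) by (simp add: ennreal_mult mult_ac)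
  finally have "ennreal m * (\<integral>\<^sup>+x. ennreal (\<bar>U x - a\<bar> powr p) * indicator B x \<partial>lborel)
      \<le> ennreal m * (ennreal (2 ^ DIM('a) * (2 * r) powr p) * E)"
    by (simp add: mult.commute)
  then show ?thesis
    unfolding a_def E_def m_def [symmetric] using m(2)
    by (subst (asm) ennreal_mult_le_mult_iff) auto
qed

section \<open>Hausdorff measure and upper densities\<close>

lemma countable_family_reindex:
  fixes D :: "'i \<Rightarrow> 'a set" and C :: "'i set"
  assumes "countable C"
  obtains E :: "nat \<Rightarrow> 'a set" where
    "(\<Union>n. E n) = (\<Union>i\<in>C. D i)" "\<And>n. E n = {} \<or> E n \<in> D ` C"
    "\<And>w :: 'a set \<Rightarrow> ennreal. w {} = 0 \<Longrightarrow> (\<Sum>n. w (E n)) = (\<integral>\<^sup>+i. w (D i) \<partial>count_space C)"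
proof
  define f where "f = to_nat_on C"
  define g where "g = inv_into C f"
  define E where "E n = (if n \<in> f ` C then D (g n) else {})" for n
  have inj: "inj_on f C" unfolding f_def using assms by (rule inj_on_to_nat_on)
  have gf: "g (f i) = i" if "i \<in> C" for i using that inj by (simp add: g_def)
  have Ef: "E (f i) = D i" if "i \<in> C" for i using that by (simp add: E_def gf)
  have "\<exists>i\<in>C. E n = D i" if "n \<in> f ` C" for n
    using that Ef by blast
  then show dich: "E n = {} \<or> E n \<in> D ` C" for n
    by (cases "n \<in> f ` C") (auto simp: E_def)
  show "(\<Union>n. E n) = (\<Union>i\<in>C. D i)"
    using dich Ef by blast
  show "(\<Sum>n. w (E n)) = (\<integral>\<^sup>+i. w (D i) \<partial>count_space C)" if "w {} = 0" for w :: "'a set \<Rightarrow> ennreal"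
  proof -
    have "(\<Sum>n. w (E n)) = (\<integral>\<^sup>+n. w (E n) * indicator (f ` C) n \<partial>count_space UNIV)"
      by (subst nn_integral_count_space_nat[symmetric], rule nn_integral_cong)
         (auto simp: E_def that indicator_def)
    also have "\<dots> = (\<integral>\<^sup>+n. w (E n) \<partial>count_space (f ` C))"
      by (simp add: nn_integral_count_space_indicator)
    also have "\<dots> = (\<integral>\<^sup>+i. w (E (f i)) \<partial>count_space C)"
      by (rule nn_integral_bij_count_space[symmetric]) (use inj in \<open>simp add: bij_betw_def\<close>)
    also have "\<dots> = (\<integral>\<^sup>+i. w (D i) \<partial>count_space C)"
      by (rule nn_integral_cong) (simp add: Ef)
    finally show ?thesis .
  qed
qed

lemma emeasure_UN_countable_le:
  fixes D :: "'i \<Rightarrow> 'a set"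
  assumes "countable C" "\<And>i. i \<in> C \<Longrightarrow> D i \<in> sets M"
  shows "emeasure M (\<Union>i\<in>C. D i) \<le> (\<integral>\<^sup>+i. emeasure M (D i) \<partial>count_space C)"
proof -
  obtain E where E: "(\<Union>n. E n) = (\<Union>i\<in>C. D i)" "\<And>n. E n = {} \<or> E n \<in> D ` C"
    "\<And>w :: 'a set \<Rightarrow> ennreal. w {} = 0 \<Longrightarrow> (\<Sum>n. w (E n)) = (\<integral>\<^sup>+i. w (D i) \<partial>count_space C)"
    using countable_family_reindex[OF assms(1), of D] by blast
  have "range E \<subseteq> sets M" using E(2) assms(2) by (metis image_iff image_subsetI sets.empty_sets)
  then have "emeasure M (\<Union>n. E n) \<le> (\<Sum>n. emeasure M (E n))"
    by (rule emeasure_subadditive_countably)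
  then show ?thesis using E(1,3) by simp
qed

lemma hausdorff_premeasure_le_countable_cover:
  fixes D :: "'i \<Rightarrow> 'a::metric_space set"
  assumes "countable C" and cover: "A \<subseteq> (\<Union>i\<in>C. D i)" and "\<delta> \<ge> 0"
    and D: "\<And>i. i \<in> C \<Longrightarrow> bounded (D i) \<and> diameter (D i) \<le> \<delta>"
  shows "hausdorff_premeasure s \<delta> A \<le> (\<integral>\<^sup>+i. ennreal (hausdorff_weight s (D i)) \<partial>count_space C)"
proof -
  obtain E where E: "(\<Union>n. E n) = (\<Union>i\<in>C. D i)" "\<And>n. E n = {} \<or> E n \<in> D ` C"
    "\<And>w :: 'a set \<Rightarrow> ennreal. w {} = 0 \<Longrightarrow> (\<Sum>n. w (E n)) = (\<integral>\<^sup>+i. w (D i) \<partial>count_space C)"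
    using countable_family_reindex[OF assms(1), of D] by blast
  have "bounded (E n) \<and> diameter (E n) \<le> \<delta>" for n
    using E(2)[of n] D \<open>\<delta> \<ge> 0\<close> by auto
  then have "hausdorff_premeasure s \<delta> A \<le> (\<Sum>n. ennreal (hausdorff_weight s (E n)))"
    unfolding hausdorff_premeasure_def using E(1) cover by (intro INF_lower) auto
  also have "\<dots> = (\<integral>\<^sup>+i. ennreal (hausdorff_weight s (D i)) \<partial>count_space C)"
    by (rule E(3)) (simp add: hausdorff_weight_def)
  finally show ?thesis .
qed

lemma hausdorff_measure_mono: "A \<subseteq> B \<Longrightarrow> hausdorff_measure s A \<le> hausdorff_measure s B"
  unfolding hausdorff_measure_def hausdorff_premeasure_def
  by (intro SUP_mono' INF_superset_mono) auto

lemma hausdorff_measure_0_iff: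
  "hausdorff_measure s A = 0 \<longleftrightarrow> (\<forall>\<delta>>0. hausdorff_premeasure s \<delta> A = 0)"
  unfolding hausdorff_measure_def by (auto simp: SUP_eq_iff SUP_bot_conv simp flip: bot_ennreal)

lemma hausdorff_measure_UN_0:
  fixes A :: "nat \<Rightarrow> 'a::metric_space set"
  assumes "\<And>n. hausdorff_measure s (A n) = 0"
  shows "hausdorff_measure s (\<Union>n. A n) = 0"
  unfolding hausdorff_measure_0_iff
proof (intro allI impI)
  fix \<delta> :: real assume \<delta>: "\<delta> > 0"
  have "hausdorff_premeasure s \<delta> (\<Union>n. A n) \<le> 0"
  proof (rule ennreal_le_epsilon)
    fix e :: real assume e: "e > 0"
    define \<epsilon> where "\<epsilon> n = e * (1 / 2) ^ Suc n" for n
    have "\<exists>C. A n \<subseteq> (\<Union>i. C i) \<and> (\<forall>i. bounded (C i) \<and> diameter (C i) \<le> \<delta>) \<and>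
        (\<Sum>i::nat. ennreal (hausdorff_weight s (C i))) \<le> ennreal (\<epsilon> n)" for n
    proof -
      have "hausdorff_premeasure s \<delta> (A n) < ennreal (\<epsilon> n)"
        using assms[of n] \<delta> e by (simp add: hausdorff_measure_0_iff \<epsilon>_def)
      then show ?thesis
        unfolding hausdorff_premeasure_def INF_less_iff by (force intro: less_imp_le)
    qed
    then obtain C where C: "\<And>n. A n \<subseteq> (\<Union>i. C n i)"
      "\<And>n i. bounded (C n i) \<and> diameter (C n i) \<le> \<delta>"
      "\<And>n. (\<Sum>i::nat. ennreal (hausdorff_weight s (C n i))) \<le> ennreal (\<epsilon> n)"
      by metis
    have "hausdorff_premeasure s \<delta> (\<Union>n. A n)
        \<le> (\<integral>\<^sup>+z. ennreal (hausdorff_weight s (case z of (n, i) \<Rightarrow> C n i)) \<partial>count_space UNIV)"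
      by (rule hausdorff_premeasure_le_countable_cover) (use C \<delta> in \<open>auto, blast+\<close>)
    also have "\<dots> = (\<integral>\<^sup>+n. (\<integral>\<^sup>+i. ennreal (hausdorff_weight s (C n i)) \<partial>count_space UNIV) \<partial>count_space UNIV)"
      using nn_integral_fst_count_space[of "\<lambda>z. ennreal (hausdorff_weight s (case z of (n, i) \<Rightarrow> C n i))"]
      by simp
    also have "\<dots> \<le> (\<integral>\<^sup>+n. ennreal (\<epsilon> n) \<partial>count_space UNIV)"
      by (rule nn_integral_mono) (simp add: nn_integral_count_space_nat C(3))
    also have "\<dots> = ennreal e"
      unfolding nn_integral_count_space_nat
    proof (rule suminf_ennreal_eq)
      show "\<epsilon> sums e"
        unfolding \<epsilon>_def [abs_def] using sums_mult[OF power_half_series, of e] by simp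
    qed (use e in \<open>simp add: \<epsilon>_def\<close>)
    finally show "hausdorff_premeasure s \<delta> (\<Union>n. A n) \<le> 0 + ennreal e" by simp
  qed
  then show "hausdorff_premeasure s \<delta> (\<Union>n. A n) = 0" by simp
qed

lemma hausdorff_weight_ball_le:
  fixes x :: "'a::euclidean_space"
  assumes "s \<ge> 0" "r > 0"
  shows "hausdorff_weight s (ball x r) \<le> unit_ball_vol s * r powr s"
\<comment> \<open>For \<open>s = 0\<close> the weight does not involve the diameter, and
  \<open>r powr 0 = 1\<close> since \<open>r > 0\<close>.\<close>
proof (cases "s = 0")
  case False
  have "(diameter (ball x r) / 2) powr s \<le> r powr s"
    using assms by (intro powr_mono2) (auto simp: diameter_ball)
  then show ?thesis
    using assms False by (auto simp: hausdorff_weight_def intro!: mult_left_mono)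
qed (use assms in \<open>auto simp: hausdorff_weight_def\<close>)

section \<open>Vitali coverings by balls of large mass\<close>

text \<open>Vitali's selection is made among the balls of large mass inside \<open>V\<close>. The
  chosen balls are disjoint, so their masses add up to at most \<open>emeasure \<nu> V\<close>,
  which controls the sum of the powers of the radii; the fivefold enlargements cover
  \<open>E\<close>.\<close>

lemma Vitali_mass_cover:
  fixes E V :: "'a::euclidean_space set" and \<nu> :: "'a measure"
  assumes sets: "sets \<nu> = sets borel" and "open V" "E \<subseteq> V" "\<epsilon> > 0" "\<delta> > 0"
    and dense: "\<And>x \<eta>. x \<in> E \<Longrightarrow> \<eta> > 0 \<Longrightarrow>
      \<exists>\<rho>. 0 < \<rho> \<and> \<rho> < \<eta> \<and> ennreal (\<epsilon> * \<rho> powr s) \<le> emeasure \<nu> (ball x \<rho>)"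
  obtains C :: "('a \<times> real) set" where "countable C"
    "\<And>x \<rho>. (x, \<rho>) \<in> C \<Longrightarrow> 0 < \<rho> \<and> \<rho> < \<delta>"
    "E \<subseteq> (\<Union>(x, \<rho>)\<in>C. ball x (5 * \<rho>))"
    "(\<integral>\<^sup>+z. ennreal (\<epsilon> * snd z powr s) \<partial>count_space C) \<le> emeasure \<nu> V"
proof -
  define K where "K = {(x, \<rho>). x \<in> E \<and> 0 < \<rho> \<and> \<rho> < \<delta> \<and> ball x \<rho> \<subseteq> V \<and>
      ennreal (\<epsilon> * \<rho> powr s) \<le> emeasure \<nu> (ball x \<rho>)}"
  have K: "\<exists>\<rho>. (x, \<rho>) \<in> K" if x: "x \<in> E" for x
  proof -
    obtain \<eta> where \<eta>: "\<eta> > 0" "ball x \<eta> \<subseteq> V"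
      using assms(2,3) x by (meson openE subsetD)
    obtain \<rho> where "0 < \<rho>" "\<rho> < min \<eta> \<delta>" "ennreal (\<epsilon> * \<rho> powr s) \<le> emeasure \<nu> (ball x \<rho>)"
      using dense[OF x, of "min \<eta> \<delta>"] \<eta> \<open>\<delta> > 0\<close> by auto
    with \<eta> x have "(x, \<rho>) \<in> K"
      using subset_ball[of \<rho> \<eta> x] by (auto simp: K_def)
    then show ?thesis ..
  qed
  have "0 < snd z \<and> snd z \<le> \<delta>" if "z \<in> K" for z
    using that by (auto simp: K_def)
  from Vitali_covering_lemma_cballs_balls[OF this, of K "\<lambda>z. z" fst]
  obtain C where C: "countable C" "C \<subseteq> K"
    "pairwise (\<lambda>i j. disjnt (cball (fst i) (snd i)) (cball (fst j) (snd j))) C"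
    "\<And>i. i \<in> K \<Longrightarrow> \<exists>j. j \<in> C \<and> cball (fst i) (snd i) \<subseteq> ball (fst j) (5 * snd j)"
    by (smt (verit))
  show ?thesis
  proof
    show "countable C" by fact
    show "0 < \<rho> \<and> \<rho> < \<delta>" if "(x, \<rho>) \<in> C" for x \<rho>
      using that C(2) by (auto simp: K_def)
    show "E \<subseteq> (\<Union>(x, \<rho>)\<in>C. ball x (5 * \<rho>))"
    proof
      fix x assume "x \<in> E"
      then obtain \<rho> where \<rho>: "(x, \<rho>) \<in> K" using K by blast
      then have "x \<in> cball x \<rho>" by (auto simp: K_def)
      with C(4)[OF \<rho>] show "x \<in> (\<Union>(x, \<rho>)\<in>C. ball x (5 * \<rho>))"
        by (force simp: case_prod_unfold)
    qed
    have "(\<integral>\<^sup>+z. ennreal (\<epsilon> * snd z powr s) \<partial>count_space C)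
        \<le> (\<integral>\<^sup>+z. emeasure \<nu> (ball (fst z) (snd z)) \<partial>count_space C)"
      using C(2) by (intro nn_integral_mono) (auto simp: K_def)
    also have "\<dots> = emeasure \<nu> (\<Union>z\<in>C. ball (fst z) (snd z))"
    proof (rule emeasure_UN_countable[symmetric])
      show "disjoint_family_on (\<lambda>z. ball (fst z) (snd z)) C"
        using C(3) ball_subset_cball
        unfolding disjoint_family_on_def pairwise_def disjnt_def by blast
    qed (use C(1) sets in auto)
    also have "\<dots> \<le> emeasure \<nu> V"
    proof (rule emeasure_mono[OF UN_least])
      fix z assume "z \<in> C"
      then show "ball (fst z) (snd z) \<subseteq> V" using C(2) by (auto simp: K_def case_prod_unfold simp del: mem_ball)
    qed (use \<open>open V\<close> sets in simp)
    finally show "(\<integral>\<^sup>+z. ennreal (\<epsilon> * snd z powr s) \<partial>count_space C) \<le> emeasure \<nu> V" .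
  qed
qed

text \<open>Serves both uses of the Vitali cover: \<open>g\<close> is the volume of an enlarged ball
  or its Hausdorff weight, and \<open>f\<close> is the power of the radius.\<close>

lemma nn_integral_powr_le_of_cover:
  assumes "\<epsilon> > 0" "c \<ge> 0" and le: "(\<integral>\<^sup>+z. ennreal (\<epsilon> * f z) \<partial>count_space C) \<le> a"
    and g: "\<And>z. z \<in> C \<Longrightarrow> g z \<le> c * f z"
  shows "(\<integral>\<^sup>+z. ennreal (g z) \<partial>count_space C) \<le> ennreal (c / \<epsilon>) * a"
proof -
  have "(\<integral>\<^sup>+z. ennreal (g z) \<partial>count_space C)
      \<le> (\<integral>\<^sup>+z. ennreal (c / \<epsilon>) * ennreal (\<epsilon> * f z) \<partial>count_space C)"
    using assms by (intro nn_integral_mono) (auto simp: ennreal_mult'[symmetric] intro!: ennreal_leI)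
  also have "\<dots> \<le> ennreal (c / \<epsilon>) * a"
    by (simp add: nn_integral_cmult mult_left_mono le)
  finally show ?thesis .
qed

text \<open>
  \<open>E\<close> is a Lebesgue null set because \<open>\<rho>\<^sup>N \<le> \<delta>\<^sup>p \<rho>\<^sup>N\<^sup>-\<^sup>p\<close> for radii below \<open>\<delta>\<close>; so \<open>\<nu>\<close>, being absolutely
  continuous, is small on suitable neighbourhoods of \<open>E\<close>, and the same covering bounds the
  Hausdorff measure.
\<close>

lemma hausdorff_measure_upper_density_0:
  fixes E :: "'a::euclidean_space set" and \<nu> :: "'a measure"
  assumes fin: "finite_measure \<nu>" and sets: "sets \<nu> = sets borel"
    and ac: "absolutely_continuous lborel \<nu>"
    and s: "0 \<le> s" "s < real DIM('a)" and \<epsilon>: "\<epsilon> > 0"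
    and dense: "\<And>x \<eta>. x \<in> E \<Longrightarrow> \<eta> > 0 \<Longrightarrow>
      \<exists>\<rho>. 0 < \<rho> \<and> \<rho> < \<eta> \<and> ennreal (\<epsilon> * \<rho> powr s) \<le> emeasure \<nu> (ball x \<rho>)"
  shows "hausdorff_measure s E = 0"
proof -
  interpret finite_measure \<nu> by fact
  define N where "N = real DIM('a)"
  define \<omega> where "\<omega> = unit_ball_vol N"
  have \<omega>: "\<omega> > 0" by (simp add: \<omega>_def N_def)
  \<comment> \<open>The volume constant of a fivefold ball times
    \<open>measure \<nu> UNIV / \<epsilon>\<close>, the bound for the sum of
    \<open>\<rho> powr s\<close>.\<close>
  define c where "c = \<omega> * 5 powr N * measure \<nu> UNIV / \<epsilon>"
  have small: "\<exists>A\<in>sets borel. E \<subseteq> A \<and> emeasure lborel A \<le> ennreal (\<delta> powr (N - s) * c)"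
    if \<delta>: "\<delta> > 0" for \<delta>
  proof -
    obtain C :: "('a \<times> real) set" where C: "countable C"
      "\<And>x \<rho>. (x, \<rho>) \<in> C \<Longrightarrow> 0 < \<rho> \<and> \<rho> < \<delta>"
      "E \<subseteq> (\<Union>(x, \<rho>)\<in>C. ball x (5 * \<rho>))"
      "(\<integral>\<^sup>+z. ennreal (\<epsilon> * snd z powr s) \<partial>count_space C) \<le> emeasure \<nu> UNIV"
      \<comment> \<open>The whole space serves as \<open>V\<close>: at this stage smallness comes
        from the radii, and \<open>\<nu>\<close> contributes its finite total mass.\<close>
      using Vitali_mass_cover[OF sets open_UNIV subset_UNIV \<epsilon> \<delta> dense] by metis
    let ?A = "\<Union>z\<in>C. ball (fst z) (5 * snd z)"
    have "emeasure lborel ?A \<le> (\<integral>\<^sup>+z. emeasure lborel (ball (fst z) (5 * snd z)) \<partial>count_space C)"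
      by (rule emeasure_UN_countable_le) (use C(1) in auto)
    also have "\<dots> = (\<integral>\<^sup>+z. ennreal (\<omega> * (5 * snd z) ^ DIM('a)) \<partial>count_space C)"
      using C(2) by (intro nn_integral_cong) (force simp: emeasure_ball \<omega>_def N_def)
    also have "\<dots> \<le> ennreal (\<omega> * 5 powr N * \<delta> powr (N - s) / \<epsilon>) * emeasure \<nu> UNIV"
    proof (rule nn_integral_powr_le_of_cover[OF \<epsilon> _ C(4)])
      fix z assume "z \<in> C"
      then have z: "0 < snd z" "snd z < \<delta>" using C(2)[of "fst z" "snd z"] by auto
      then have "\<omega> * (5 * snd z) ^ DIM('a) = \<omega> * (5 powr N * (snd z powr (N - s) * snd z powr s))"
        by (simp add: N_def powr_mult powr_realpow flip: powr_add)
      also have "\<dots> \<le> \<omega> * (5 powr N * (\<delta> powr (N - s) * snd z powr s))"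
        using z \<omega> s by (intro mult_left_mono mult_right_mono powr_mono2) (auto simp: N_def)
      finally show "\<omega> * (5 * snd z) ^ DIM('a) \<le> \<omega> * 5 powr N * \<delta> powr (N - s) * snd z powr s"
        by (simp add: mult.assoc)
    qed (use \<omega> in auto)
    also have "\<dots> = ennreal (\<delta> powr (N - s) * c)"
      using \<omega> \<epsilon> by (simp add: emeasure_eq_measure c_def ennreal_mult'[symmetric] mult_ac)
    finally show ?thesis
      using C(3) by (intro bexI[of _ ?A] conjI borel_open open_UN) (auto simp: case_prod_unfold)
  qed
  have "negligible E"
  proof (rule negligible_outer_le[THEN iffD2], intro allI impI)
    fix e :: real assume e: "e > 0"
    have "((\<lambda>\<delta>. \<delta> powr (N - s) * c) \<longlongrightarrow> 0 powr (N - s) * c) (at_right 0)"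
      using s by (intro tendsto_intros tendsto_powr2) (auto simp: N_def eventually_at_filter)
    then have "eventually (\<lambda>\<delta>. \<delta> powr (N - s) * c < e) (at_right 0)"
      using e by (auto dest!: order_tendstoD(2)[of _ _ _ e])
    then have "eventually (\<lambda>\<delta>. \<delta> powr (N - s) * c < e \<and> \<delta> > 0) (at_right 0)"
      using eventually_at_right_less by (rule eventually_conj)
    then obtain \<delta> where \<delta>: "\<delta> > 0" "\<delta> powr (N - s) * c < e"
      using eventually_happens trivial_limit_at_right_real by blast
    obtain A where A: "A \<in> sets borel" "E \<subseteq> A" "emeasure lborel A \<le> ennreal (\<delta> powr (N - s) * c)"
      using small[OF \<delta>(1)] by blast
    then have le: "emeasure lborel A \<le> ennreal e"
      using \<delta>(2) by (meson ennreal_leI less_imp_le order_trans)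
    show "\<exists>T. E \<subseteq> T \<and> T \<in> lmeasurable \<and> measure lebesgue T \<le> e"
    proof (intro exI conjI)
      show "E \<subseteq> A" by fact
      have fin: "emeasure lborel A < \<infinity>" using le by (simp add: order_le_less_trans)
      then show "A \<in> lmeasurable"
        using A(1) by (intro fmeasurableI) auto
      show "measure lebesgue A \<le> e"
        using A(1) le e by (simp add: measure_def enn2real_leI)
    qed
  qed
  then have "E \<in> null_sets (completion lborel)"
    by (simp add: negligible_iff_null_sets)
  \<comment> \<open>\<open>E\<close> may fail to be Borel, so absolute continuity is applied to a
    Borel null set containing it.\<close>
  then obtain A where A: "A \<in> null_sets lborel" "E \<subseteq> A"
    by (auto simp: null_sets_completion_iff2)
  have \<nu>A: "emeasure \<nu> A = 0"
    using A(1) ac by (auto simp: absolutely_continuous_def null_sets_def)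
  define k where "k = unit_ball_vol s * 5 powr s / \<epsilon>"
  have k: "k > 0" using s \<epsilon> by (simp add: k_def)
  show ?thesis
    unfolding hausdorff_measure_0_iff
  proof (intro allI impI)
    fix \<delta> :: real assume \<delta>: "\<delta> > 0"
    have "hausdorff_premeasure s \<delta> E \<le> 0"
    proof (rule ennreal_le_epsilon)
      fix e :: real assume e: "e > 0"
      \<comment> \<open>Outer regularity turns \<open>emeasure \<nu> A = 0\<close> into open
        neighbourhoods of arbitrarily small mass; \<open>e / k\<close> offsets the constant
        \<open>k\<close> of the covering.\<close>
      have "emeasure \<nu> A = (INF U\<in>{U. A \<subseteq> U \<and> open U}. emeasure \<nu> U)"
        using A(1) by (intro outer_regular sets) (auto simp: emeasure_eq_measure)
      moreover have "0 < ennreal (e / k)" using e k by simp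
      ultimately obtain V where V: "A \<subseteq> V" "open V" "emeasure \<nu> V < ennreal (e / k)"
        unfolding \<nu>A by (metis (no_types, lifting) INF_less_iff mem_Collect_eq)
      have "E \<subseteq> V" using A V by blast
      \<comment> \<open>The enlarged balls have radius \<open>5 * \<rho> < \<delta> / 2\<close>,
        hence diameter at most \<open>\<delta>\<close>.\<close>
      have "\<delta> / 10 > 0" using \<delta> by simp
      from Vitali_mass_cover[OF sets V(2) \<open>E \<subseteq> V\<close> \<epsilon> this dense]
      obtain C :: "('a \<times> real) set" where C: "countable C"
        "\<And>x \<rho>. (x, \<rho>) \<in> C \<Longrightarrow> 0 < \<rho> \<and> \<rho> < \<delta> / 10"
        "E \<subseteq> (\<Union>(x, \<rho>)\<in>C. ball x (5 * \<rho>))"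
        "(\<integral>\<^sup>+z. ennreal (\<epsilon> * snd z powr s) \<partial>count_space C) \<le> emeasure \<nu> V"
        by metis
      have "hausdorff_premeasure s \<delta> E
          \<le> (\<integral>\<^sup>+z. ennreal (hausdorff_weight s (ball (fst z) (5 * snd z))) \<partial>count_space C)"
        by (rule hausdorff_premeasure_le_countable_cover)
           (use C \<delta> in \<open>force simp: case_prod_unfold diameter_ball\<close>)+
      also have "\<dots> \<le> ennreal (unit_ball_vol s * 5 powr s / \<epsilon>) * emeasure \<nu> V"
      proof (rule nn_integral_powr_le_of_cover[OF \<epsilon> _ C(4)])
        fix z assume "z \<in> C"
        then have z: "0 < snd z" using C(2)[of "fst z" "snd z"] by auto
        then show "hausdorff_weight s (ball (fst z) (5 * snd z)) \<le> unit_ball_vol s * 5 powr s * snd z powr s"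
          using hausdorff_weight_ball_le[OF s(1), of "5 * snd z" "fst z"] by (simp add: powr_mult)
      qed (use s in auto)
      also have "\<dots> \<le> ennreal k * ennreal (e / k)"
        unfolding k_def [symmetric] using V(3) by (intro mult_left_mono) auto
      also have "\<dots> = ennreal e"
        using k e by (simp flip: ennreal_mult)
      finally show "hausdorff_premeasure s \<delta> E \<le> 0 + ennreal e" by simp
    qed
    then show "hausdorff_premeasure s \<delta> E = 0" by simp
  qed
qed

section \<open>Mean oscillation of Sobolev functions\<close>

text \<open>Sobolev functions are measurable for the completed measure on \<open>\<Omega>\<close>,
  while the Fubini arguments run over products of \<open>lborel\<close> and use Borel
  functions.\<close>

lemma borel_version_on:
  fixes f :: "'a::euclidean_space \<Rightarrow> real"
  assumes "f \<in> borel_measurable (lebesgue_on S)" "S \<in> sets borel"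
  obtains f' where "f' \<in> borel_measurable borel" "AE x in lborel. x \<in> S \<longrightarrow> f x = f' x"
proof -
  have "(\<lambda>x. indicator S x *\<^sub>R f x) \<in> borel_measurable lebesgue"
    using assms by (subst borel_measurable_restrict_space_iff[symmetric]) auto
  then obtain f' where f': "f' \<in> borel_measurable lborel" "AE x in lborel. indicator S x *\<^sub>R f x = f' x"
    using completion_ex_borel_measurable_real by blast
  from f'(2) have "AE x in lborel. x \<in> S \<longrightarrow> f x = f' x"
    by eventually_elim auto
  with f'(1) show thesis by (intro that) auto
qed

lemma
  fixes f f' :: "'a::euclidean_space \<Rightarrow> real"
  assumes S: "S \<in> sets borel" and f': "f' \<in> borel_measurable borel"
    and f: "f \<in> borel_measurable (lebesgue_on S)"
    and eq: "AE x in lborel. x \<in> S \<longrightarrow> f x = f' x"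
  shows integral_lebesgue_on_borel_version:
      "(\<integral>x. f x \<partial>lebesgue_on S) = (\<integral>x. indicator S x * f' x \<partial>lborel)"
    and integrable_lebesgue_on_borel_version:
      "integrable (lebesgue_on S) f \<longleftrightarrow> integrable lborel (\<lambda>x. indicator S x * f' x)"
proof -
  have S': "S \<inter> space lebesgue \<in> sets lebesgue" using S by simp
  have m: "(\<lambda>x. indicator S x *\<^sub>R f x) \<in> borel_measurable lebesgue"
    using f S by (subst borel_measurable_restrict_space_iff[symmetric]) auto
  have m': "(\<lambda>x. indicator S x * f' x) \<in> borel_measurable lborel"
    using f' S by simp
  then have m'': "(\<lambda>x. indicator S x * f' x) \<in> borel_measurable lebesgue"
    by (rule measurable_completion)
  have ae: "AE x in lebesgue. indicator S x *\<^sub>R f x = indicator S x * f' x"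
    using AE_completion[OF eq] by eventually_elim (auto simp: indicator_def)
  show "(\<integral>x. f x \<partial>lebesgue_on S) = (\<integral>x. indicator S x * f' x \<partial>lborel)"
    using integral_cong_AE[OF m m'' ae] integral_completion[OF m']
    by (simp add: integral_restrict_space[OF S'])
  show "integrable (lebesgue_on S) f \<longleftrightarrow> integrable lborel (\<lambda>x. indicator S x * f' x)"
    using integrable_cong_AE[OF m m'' ae] integrable_completion[OF m']
    by (simp add: integrable_restrict_space[OF S'])
qed

text \<open>Near such a point the function is identically 0. Hence a test function supported in a
  ball vanishes outside it together with its derivative, and both sides of the weak identity become
  integrals over the whole space.\<close>

lemma frechet_derivative_outside_support:
  fixes f :: "'a::real_normed_vector \<Rightarrow> real"
  assumes "x \<notin> closure {x. f x \<noteq> 0}"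
  shows "frechet_derivative f (at x) = (\<lambda>_. 0)"
proof -
  have "(f has_derivative (\<lambda>_. 0)) (at x)"
  proof (rule has_derivative_transform_within_open)
    show "((\<lambda>_. 0) has_derivative (\<lambda>_. 0)) (at x)" by simp
    show "open (- closure {x. f x \<noteq> 0})" by auto
    show "0 = f y" if "y \<in> - closure {x. f x \<noteq> 0}" for y
      using that closure_subset[of "{x. f x \<noteq> 0}"] by auto
  qed (use assms in simp)
  then show ?thesis by (metis frechet_derivative_at)
qed

text \<open>Each term is at most the largest one, whose power is itself a summand. The constant is
  crude, but only integrability is drawn from it.\<close>

lemma sum_powr_le:
  fixes f :: "'i \<Rightarrow> real"
  assumes "finite I" "p > 0"
  shows "(\<Sum>i\<in>I. \<bar>f i\<bar>) powr p \<le> real (card I) powr p * (\<Sum>i\<in>I. \<bar>f i\<bar> powr p)"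
proof (cases "I = {}")
  case False
  define m where "m = Max ((\<lambda>i. \<bar>f i\<bar>) ` I)"
  have "m \<in> (\<lambda>i. \<bar>f i\<bar>) ` I"
    unfolding m_def using assms False by (intro Max_in) auto
  then obtain j where j: "j \<in> I" "m = \<bar>f j\<bar>" by auto
  have "(\<Sum>i\<in>I. \<bar>f i\<bar>) \<le> (\<Sum>i\<in>I. m)"
    unfolding m_def using assms by (intro sum_mono Max_ge) auto
  then have "(\<Sum>i\<in>I. \<bar>f i\<bar>) powr p \<le> (real (card I) * m) powr p"
    using assms by (intro powr_mono2) (auto intro: sum_nonneg)
  also have "\<dots> = real (card I) powr p * \<bar>f j\<bar> powr p"
    by (simp add: powr_mult j)
  also have "\<dots> \<le> real (card I) powr p * (\<Sum>i\<in>I. \<bar>f i\<bar> powr p)"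
    using assms j by (intro mult_left_mono member_le_sum) auto
  finally show ?thesis .
qed simp

lemma not_tendsto_0_at_rightD:
  fixes f :: "real \<Rightarrow> real"
  assumes "\<not> (f \<longlongrightarrow> 0) (at_right 0)" "\<And>\<rho>. f \<rho> \<ge> 0"
  obtains e where "e > 0" "\<And>\<eta>. \<eta> > 0 \<Longrightarrow> \<exists>\<rho>. 0 < \<rho> \<and> \<rho> < \<eta> \<and> e \<le> f \<rho>"
proof -
  obtain e where e: "e > 0" "\<not> eventually (\<lambda>\<rho>. dist (f \<rho>) 0 < e) (at_right 0)"
    using assms(1) unfolding tendsto_iff by blast
  show thesis
  proof (rule that[OF e(1)])
    fix \<eta> :: real assume "\<eta> > 0"
    then show "\<exists>\<rho>. 0 < \<rho> \<and> \<rho> < \<eta> \<and> e \<le> f \<rho>"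
      using e(2) assms(2) unfolding eventually_at_right_field by (force simp: not_less)
  qed
qed

text \<open>Closed balls appear because local integrability is tested on compact sets.\<close>

lemma eventually_cball_subset:
  fixes S :: "'a::metric_space set"
  assumes "open S" "x \<in> S"
  shows "eventually (\<lambda>\<rho>. cball x \<rho> \<subseteq> S) (at_right 0)"
proof -
  obtain e where "e > 0" "cball x e \<subseteq> S" using assms open_contains_cball by blast
  then show ?thesis
    unfolding eventually_at_right_field by (intro exI[of _ e]) (auto simp: subset_iff)
qed

lemma average_nonneg: "(\<And>y. f y \<ge> 0) \<Longrightarrow> average S f \<ge> 0"
  by (simp add: average_def)

section \<open>Oscillation estimates and the exceptional set\<close>

definition mean_oscillation :: "real \<Rightarrow> ('a::euclidean_space \<Rightarrow> real) \<Rightarrow> 'a \<Rightarrow> real \<Rightarrow> real" where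
  "mean_oscillation p u x \<rho> =
     average (ball x \<rho>) (\<lambda>y. \<bar>u y - average (ball x \<rho>) u\<bar> powr p)"

lemma mean_oscillation_nonneg: "mean_oscillation p u x \<rho> \<ge> 0"
  by (simp add: mean_oscillation_def average_nonneg)

lemma mean_oscillation_eq:
  "mean_oscillation p u x \<rho> = (\<integral>y. \<bar>u y - average (ball x \<rho>) u\<bar> powr p \<partial>lebesgue_on (ball x \<rho>))
    / measure lebesgue (ball x \<rho>)"
  unfolding mean_oscillation_def by (rule average_def)

text \<open>One measure \<open>\<nu>\<close> serves all balls, as the covering argument requires.
  Integrability is asserted separately: without it the Bochner integral would be 0 and the bound on
  \<open>mean_oscillation\<close> would carry no information.\<close>

lemma W1p_mean_oscillation_le:
  fixes \<Omega> :: "'a::euclidean_space set"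
  assumes \<Omega>: "open \<Omega>" and p: "p > 1" and u: "u \<in> W1p p \<Omega>"
  obtains \<nu> :: "'a measure" where
    "finite_measure \<nu>" "sets \<nu> = sets borel" "absolutely_continuous lborel \<nu>"
    "\<And>x r. r > 0 \<Longrightarrow> cball x r \<subseteq> \<Omega> \<Longrightarrow>
      integrable (lebesgue_on (ball x r)) (\<lambda>y. \<bar>u y - average (ball x r) u\<bar> powr p)"
    "\<And>x r. r > 0 \<Longrightarrow> cball x r \<subseteq> \<Omega> \<Longrightarrow>
      mean_oscillation p u x r * measure lborel (ball x r)
        \<le> 2 ^ DIM('a) * (2 * r) powr p * measure \<nu> (ball x r)"
proof -
  have \<Omega>_borel [measurable]: "\<Omega> \<in> sets borel" using \<Omega> by simp
  from u have "\<forall>i\<in>Basis. \<exists>g. g \<in> Lp p \<Omega> \<and> weak_partial_derivative \<Omega> i u g"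
    by (auto simp: W1p_def)
  then obtain g where g: "\<And>i. i \<in> Basis \<Longrightarrow> g i \<in> Lp p \<Omega>"
    "\<And>i. i \<in> Basis \<Longrightarrow> weak_partial_derivative \<Omega> i u (g i)"
    by metis
  have u_meas: "u \<in> borel_measurable (lebesgue_on \<Omega>)"
    using u by (simp add: W1p_def Lp_def)
  have g_meas: "g i \<in> borel_measurable (lebesgue_on \<Omega>)" if "i \<in> Basis" for i
    using g(1)[OF that] by (simp add: Lp_def)
  obtain v where v: "v \<in> borel_measurable borel" "AE x in lborel. x \<in> \<Omega> \<longrightarrow> u x = v x"
    using borel_version_on[OF u_meas \<Omega>_borel] by blast
  have "\<forall>i\<in>Basis. \<exists>w. w \<in> borel_measurable borel \<and> (AE x in lborel. x \<in> \<Omega> \<longrightarrow> g i x = w x)"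
    using borel_version_on[OF g_meas \<Omega>_borel] by metis
  then obtain w where w: "\<And>i. i \<in> Basis \<Longrightarrow> w i \<in> borel_measurable borel"
    "\<And>i. i \<in> Basis \<Longrightarrow> AE x in lborel. x \<in> \<Omega> \<longrightarrow> g i x = w i x"
    by metis
  note [measurable] = v(1) w(1)
  have restrict: "f \<in> borel_measurable (lebesgue_on S)"
    if "f \<in> borel_measurable (lebesgue_on \<Omega>)" "S \<subseteq> \<Omega>" for f :: "'a \<Rightarrow> real" and S
    using that by (rule measurable_restrict_mono)
  have loc: "integrable lborel (\<lambda>x. indicator (ball z r) x * f' x)"
    if f: "locally_integrable_on f \<Omega>" and f': "f' \<in> borel_measurable borel"
      "AE x in lborel. x \<in> \<Omega> \<longrightarrow> f x = f' x" and z: "cball z r \<subseteq> \<Omega>" for f f' :: "'a \<Rightarrow> real" and z r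
  proof -
    have int: "integrable (lebesgue_on (cball z r)) f"
      using f z by (simp add: locally_integrable_on_def)
    have "AE x in lborel. x \<in> cball z r \<longrightarrow> f x = f' x"
      using f'(2) by eventually_elim (use z in auto)
    then have "integrable lborel (\<lambda>x. indicator (cball z r) x * f' x)"
      using integrable_lebesgue_on_borel_version[OF _ f'(1), of "cball z r" f] int by simp
    from integrable_mult_indicator[OF _ this, of "ball z r"] show ?thesis
      by (rule Bochner_Integration.integrable_cong[THEN iffD1, rotated 2])
         (auto simp: indicator_def)
  qed
  \<comment> \<open>The gradient is measured by the sum of its absolute components, as in
    \<open>Poincare_ball\<close>.\<close>
  define \<Gamma> where "\<Gamma> x = (\<Sum>i\<in>Basis. \<bar>w i x\<bar>) powr p" for x
  have [measurable]: "\<Gamma> \<in> borel_measurable borel" unfolding \<Gamma>_def [abs_def] by measurable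
  define \<nu> where "\<nu> = density lborel (\<lambda>x. ennreal (\<Gamma> x) * indicator \<Omega> x)"
  have sets_\<nu>: "sets \<nu> = sets borel" by (simp add: \<nu>_def)
  have \<nu>_eq: "emeasure \<nu> S = (\<integral>\<^sup>+x. ennreal (\<Gamma> x) * indicator S x \<partial>lborel)"
    if "S \<in> sets borel" "S \<subseteq> \<Omega>" for S
    unfolding \<nu>_def using that
    by (subst emeasure_density) (auto intro!: nn_integral_cong simp: indicator_def)
  have "integrable lborel (\<lambda>x. \<Gamma> x * indicator \<Omega> x)"
  proof (rule Bochner_Integration.integrable_bound)
    show "integrable lborel (\<lambda>x. real DIM('a) powr p * (\<Sum>i\<in>Basis. indicator \<Omega> x * \<bar>w i x\<bar> powr p))"
    proof (intro integrable_mult_right Bochner_Integration.integrable_sum)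
      fix i :: 'a assume i: "i \<in> Basis"
      have "AE x in lborel. x \<in> \<Omega> \<longrightarrow> \<bar>g i x\<bar> powr p = \<bar>w i x\<bar> powr p"
        using w(2)[OF i] by eventually_elim auto
      moreover have "integrable (lebesgue_on \<Omega>) (\<lambda>x. \<bar>g i x\<bar> powr p)"
        using g(1)[OF i] by (simp add: Lp_def)
      ultimately show "integrable lborel (\<lambda>x. indicator \<Omega> x * \<bar>w i x\<bar> powr p)"
        using integrable_lebesgue_on_borel_version[of \<Omega> "\<lambda>x. \<bar>w i x\<bar> powr p" "\<lambda>x. \<bar>g i x\<bar> powr p"] i
        by simp
    qed
    show "AE x in lborel. norm (\<Gamma> x * indicator \<Omega> x)
        \<le> norm (real DIM('a) powr p * (\<Sum>i\<in>Basis. indicator \<Omega> x * \<bar>w i x\<bar> powr p))"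
    proof (rule AE_I2)
      fix x
      have "\<Gamma> x \<le> real DIM('a) powr p * (\<Sum>i\<in>Basis. \<bar>w i x\<bar> powr p)"
        unfolding \<Gamma>_def using p by (intro sum_powr_le) auto
      then show "norm (\<Gamma> x * indicator \<Omega> x)
          \<le> norm (real DIM('a) powr p * (\<Sum>i\<in>Basis. indicator \<Omega> x * \<bar>w i x\<bar> powr p))"
        by (auto simp: indicator_def \<Gamma>_def sum_nonneg abs_mult)
    qed
  qed measurable
  then have "(\<integral>\<^sup>+x. ennreal (norm (\<Gamma> x * indicator \<Omega> x)) \<partial>lborel) < \<infinity>"
    by (simp add: integrable_iff_bounded)
  also have "(\<integral>\<^sup>+x. ennreal (norm (\<Gamma> x * indicator \<Omega> x)) \<partial>lborel) = emeasure \<nu> UNIV"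
    unfolding \<nu>_def by (subst emeasure_density) (auto intro!: nn_integral_cong simp: indicator_def \<Gamma>_def)
  finally have fin: "finite_measure \<nu>"
    by (intro finite_measureI) (auto simp: \<nu>_def)
  interpret finite_measure \<nu> by (rule fin)
  have ac: "absolutely_continuous lborel \<nu>"
    unfolding \<nu>_def by (rule absolutely_continuousI_density) measurable
  have Poincare: "integrable (lebesgue_on (ball z r)) (\<lambda>y. \<bar>u y - average (ball z r) u\<bar> powr p)
      \<and> mean_oscillation p u z r * measure lborel (ball z r)
        \<le> 2 ^ DIM('a) * (2 * r) powr p * measure \<nu> (ball z r)"
    if r: "r > 0" and z: "cball z r \<subseteq> \<Omega>" for z r
  proof -
    define B where "B = ball z r"
    have [measurable]: "B \<in> sets borel" by (simp add: B_def)
    have B: "B \<subseteq> \<Omega>" using z by (auto simp: B_def)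
    have v_AE: "AE x in lborel. x \<in> B \<longrightarrow> u x = v x"
      using v(2) by eventually_elim (use B in auto)
    \<comment> \<open>The extension by zero may jump across the boundary of \<open>B\<close>, which
      is harmless: \<open>weak_gradient\<close> tests only with supports inside
      \<open>B\<close>.\<close>
    define U where "U x = indicator B x * v x" for x
    define G where "G i x = indicator B x * w i x" for i x
    have "weak_gradient B U G"
    proof
      show "convex B" "open B" by (simp_all add: B_def)
      show "integrable lborel U"
        \<comment> \<open>Local integrability of \<open>u\<close> is part of any one weak partial
          derivative.\<close>
        unfolding U_def [abs_def] B_def using g(2)[OF SOME_Basis] v z
        by (intro loc[of u]) (auto simp: weak_partial_derivative_def)
      show "integrable lborel (G i)" if "i \<in> Basis" for i
        unfolding G_def [abs_def] B_def using g(2) w that z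
        by (intro loc[of "g i"]) (auto simp: weak_partial_derivative_def)
      fix i :: 'a and \<phi> :: "'a \<Rightarrow> real"
      assume i: "i \<in> Basis" and \<phi>: "\<phi> \<in> bump_algebra" "compact (closure {x. \<phi> x \<noteq> 0})"
        "closure {x. \<phi> x \<noteq> 0} \<subseteq> B"
      let ?D = "\<lambda>x. frechet_derivative \<phi> (at x) i"
      have meas: "\<phi> \<in> borel_measurable borel" "?D \<in> borel_measurable borel"
        using \<phi>(1) bump_algebra_frechet_derivative[OF \<phi>(1)]
        by (auto intro!: borel_measurable_continuous_onI bump_algebra_continuous)
      have meas_on: "f \<in> borel_measurable (lebesgue_on \<Omega>)" if "f \<in> borel_measurable borel" for f :: "'a \<Rightarrow> real"
        using that by (intro measurable_restrict_space1 measurable_completion) simp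
      have vanish: "\<phi> x = 0 \<and> ?D x = 0" if "x \<notin> B" for x
      proof -
        have "x \<notin> closure {x. \<phi> x \<noteq> 0}" using that \<phi>(3) by blast
        then show ?thesis
          using frechet_derivative_outside_support[of x \<phi>] closure_subset[of "{x. \<phi> x \<noteq> 0}"] by auto
      qed
      have "(\<integral>x. u x * ?D x \<partial>lebesgue_on \<Omega>) = (\<integral>x. indicator \<Omega> x * (v x * ?D x) \<partial>lborel)"
      proof (rule integral_lebesgue_on_borel_version)
        show "AE x in lborel. x \<in> \<Omega> \<longrightarrow> u x * ?D x = v x * ?D x"
          using v(2) by eventually_elim auto
        show "(\<lambda>x. u x * ?D x) \<in> borel_measurable (lebesgue_on \<Omega>)"
          by (intro borel_measurable_times u_meas meas_on meas)
      qed (use meas in measurable)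
      also have "\<dots> = (\<integral>x. U x * ?D x \<partial>lborel)"
        using vanish B by (intro Bochner_Integration.integral_cong) (auto simp: U_def indicator_def)
      finally have 1: "(\<integral>x. u x * ?D x \<partial>lebesgue_on \<Omega>) = (\<integral>x. U x * ?D x \<partial>lborel)" .
      have "(\<integral>x. g i x * \<phi> x \<partial>lebesgue_on \<Omega>) = (\<integral>x. indicator \<Omega> x * (w i x * \<phi> x) \<partial>lborel)"
      proof (rule integral_lebesgue_on_borel_version)
        show "AE x in lborel. x \<in> \<Omega> \<longrightarrow> g i x * \<phi> x = w i x * \<phi> x"
          using w(2)[OF i] by eventually_elim auto
        show "(\<lambda>x. g i x * \<phi> x) \<in> borel_measurable (lebesgue_on \<Omega>)"
          by (intro borel_measurable_times g_meas i meas_on meas)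
      qed (use meas i in measurable)
      also have "\<dots> = (\<integral>x. G i x * \<phi> x \<partial>lborel)"
        using vanish B by (intro Bochner_Integration.integral_cong) (auto simp: G_def indicator_def)
      finally have 2: "(\<integral>x. g i x * \<phi> x \<partial>lebesgue_on \<Omega>) = (\<integral>x. G i x * \<phi> x \<partial>lborel)" .
      have "test_function \<Omega> \<phi>"
        using \<phi> B bump_algebra_C_k by (auto simp: test_function_def)
      then show "(\<integral>x. U x * ?D x \<partial>lborel) = - (\<integral>x. G i x * \<phi> x \<partial>lborel)"
        using g(2)[OF i] by (simp add: weak_partial_derivative_def flip: 1 2)
    qed
    define m where "m = measure lborel B"
    define a where "a = average B u"
    have m: "m > 0" using r by (simp add: m_def B_def content_ball)
    have "(\<integral>x. u x \<partial>lebesgue_on B) = (\<integral>x. indicator B x * v x \<partial>lborel)"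
      by (rule integral_lebesgue_on_borel_version) (use restrict[OF u_meas B] v_AE in auto)
    then have a: "a = (\<integral>y. indicator B y * U y \<partial>lborel) / m"
      by (simp add: a_def average_def m_def U_def flip: mult.assoc indicator_inter_arith)
    have "(\<integral>\<^sup>+x. ennreal (\<bar>U x - a\<bar> powr p) * indicator B x \<partial>lborel)
        \<le> ennreal (2 ^ DIM('a) * (2 * r) powr p)
          * (\<integral>\<^sup>+x. ennreal ((\<Sum>i\<in>Basis. \<bar>G i x\<bar>) powr p) * indicator B x \<partial>lborel)"
      using Poincare_ball[OF \<open>weak_gradient B U G\<close>[unfolded B_def] r, of p] p
      by (simp add: a m_def B_def)
    also have "(\<integral>\<^sup>+x. ennreal ((\<Sum>i\<in>Basis. \<bar>G i x\<bar>) powr p) * indicator B x \<partial>lborel) = emeasure \<nu> B"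
      using B by (subst \<nu>_eq) (auto intro!: nn_integral_cong simp: G_def \<Gamma>_def indicator_def)
    also have "(\<integral>\<^sup>+x. ennreal (\<bar>U x - a\<bar> powr p) * indicator B x \<partial>lborel)
        = (\<integral>\<^sup>+x. ennreal (indicator B x * \<bar>v x - a\<bar> powr p) \<partial>lborel)"
      by (intro nn_integral_cong) (auto simp: U_def indicator_def)
    finally have le: "(\<integral>\<^sup>+x. ennreal (indicator B x * \<bar>v x - a\<bar> powr p) \<partial>lborel)
        \<le> ennreal (2 ^ DIM('a) * (2 * r) powr p * measure \<nu> B)"
      by (simp add: emeasure_eq_measure ennreal_mult)
    have osc_meas: "(\<lambda>x. \<bar>u x - a\<bar> powr p) \<in> borel_measurable (lebesgue_on B)"
      using restrict[OF u_meas B] by simp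
    have osc_AE: "AE x in lborel. x \<in> B \<longrightarrow> \<bar>u x - a\<bar> powr p = \<bar>v x - a\<bar> powr p"
      using v_AE by eventually_elim auto
    \<comment> \<open>The finite right side of Poincare's inequality is what makes the oscillation
      integrable.\<close>
    have int: "integrable lborel (\<lambda>x. indicator B x * \<bar>v x - a\<bar> powr p)"
      using le by (intro integrableI_bounded) (auto simp: order_le_less_trans[OF le])
    then have "integrable (lebesgue_on B) (\<lambda>x. \<bar>u x - a\<bar> powr p)"
      by (subst integrable_lebesgue_on_borel_version[OF _ _ osc_meas osc_AE]) auto
    moreover have "mean_oscillation p u z r * m = (\<integral>x. indicator B x * \<bar>v x - a\<bar> powr p \<partial>lborel)"
      using integral_lebesgue_on_borel_version[OF _ _ osc_meas osc_AE] m
      by (simp add: mean_oscillation_eq a_def B_def m_def)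
    moreover have "(\<integral>x. indicator B x * \<bar>v x - a\<bar> powr p \<partial>lborel) \<le> 2 ^ DIM('a) * (2 * r) powr p * measure \<nu> B"
      using le by (subst (asm) nn_integral_eq_integral[OF int]) auto
    ultimately show ?thesis by (simp add: a_def B_def m_def)
  qed
  then show thesis
    using that[OF fin sets_\<nu> ac] by blast
qed

text \<open>Stands in for Hoelder's inequality when the \<open>L\<^sup>1\<close> oscillation is bounded by the \<open>L\<^sup>p\<close> one.\<close>

lemma le_add_powr:
  fixes t \<delta> p :: real
  assumes "t \<ge> 0" "\<delta> > 0" "p > 1"
  shows "t \<le> \<delta> + \<delta> powr (1 - p) * t powr p"
proof (cases "t \<le> \<delta>")
  case False
  then have "t powr (1 - p) \<le> \<delta> powr (1 - p)"
    using assms by (intro powr_mono2') auto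
  then have "t powr (1 - p) * t powr p \<le> \<delta> powr (1 - p) * t powr p"
    by (rule mult_right_mono) simp
  also have "t powr (1 - p) * t powr p = t"
    using False assms by (simp flip: powr_add)
  finally show ?thesis using assms by simp
qed (use assms in \<open>auto intro: add_increasing2\<close>)

text \<open>The mean of \<open>u\<close> is taken as the competitor \<open>c\<close>, and
  \<open>le_add_powr\<close> is averaged over the ball.\<close>

lemma INF_average_le:
  assumes p: "p > 1" and \<delta>: "\<delta> > 0" and r: "r > 0"
    and u: "u \<in> borel_measurable (lebesgue_on (ball x r))"
    and int: "integrable (lebesgue_on (ball x r)) (\<lambda>y. \<bar>u y - average (ball x r) u\<bar> powr p)"
  shows "(INF c. average (ball x r) (\<lambda>y. \<bar>u y - c\<bar>)) \<le> \<delta> + \<delta> powr (1 - p) * mean_oscillation p u x r"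
proof -
  let ?B = "ball x r"
  let ?M = "lebesgue_on ?B"
  define a where "a = average ?B u"
  define m where "m = measure lebesgue ?B"
  have m: "m > 0" using r by (simp add: m_def content_ball)
  interpret finite_measure ?M
    by (rule finite_measureI)
       (use r in \<open>simp add: emeasure_restrict_space space_restrict_space emeasure_ball\<close>)
  have le: "\<bar>u y - a\<bar> \<le> \<delta> + \<delta> powr (1 - p) * \<bar>u y - a\<bar> powr p" for y
    by (rule le_add_powr) (use \<delta> p in auto)
  have bound: "integrable ?M (\<lambda>y. \<delta> + \<delta> powr (1 - p) * \<bar>u y - a\<bar> powr p)"
    using int by (auto simp: a_def)
  then have int1: "integrable ?M (\<lambda>y. \<bar>u y - a\<bar>)"
    by (rule Bochner_Integration.integrable_bound)
       (use u le in \<open>auto intro: order_trans[OF le abs_ge_self]\<close>)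
  have "(INF c. average ?B (\<lambda>y. \<bar>u y - c\<bar>)) \<le> average ?B (\<lambda>y. \<bar>u y - a\<bar>)"
    by (rule cINF_lower) (auto intro!: bdd_belowI[of _ 0] average_nonneg)
  also have "\<dots> \<le> (\<integral>y. \<delta> + \<delta> powr (1 - p) * \<bar>u y - a\<bar> powr p \<partial>?M) / m"
    unfolding average_def m_def [symmetric] using m
    by (intro divide_right_mono integral_mono int1 bound le) auto
  also have "\<dots> = \<delta> + \<delta> powr (1 - p) * mean_oscillation p u x r"
  proof -
    have "measure ?M (space ?M) = m"
      by (simp add: measure_restrict_space space_restrict_space m_def)
    then show ?thesis
      using int m by (simp add: mean_oscillation_eq a_def
          m_def [symmetric] add_divide_distrib)
  qed
  finally show ?thesis .
qed

lemma singular_set_subset: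
  fixes \<Omega> :: "'a::euclidean_space set"
  assumes \<Omega>: "open \<Omega>" and p: "p > 1" and u: "u \<in> W1p p \<Omega>"
  shows "singular_set \<Omega> u \<subseteq> {x \<in> \<Omega>. \<not> (mean_oscillation p u x \<longlongrightarrow> 0) (at_right 0)}"
proof -
  have int: "integrable (lebesgue_on (ball x r)) (\<lambda>y. \<bar>u y - average (ball x r) u\<bar> powr p)"
    if r: "r > 0" and sub: "cball x r \<subseteq> \<Omega>" for x r
  proof (rule W1p_mean_oscillation_le[OF \<Omega> p u])
    assume int: "\<And>x r. r > 0 \<Longrightarrow> cball x r \<subseteq> \<Omega> \<Longrightarrow>
      integrable (lebesgue_on (ball x r)) (\<lambda>y. \<bar>u y - average (ball x r) u\<bar> powr p)"
    show ?thesis by (rule int[OF r sub])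
  qed
  have "((\<lambda>\<rho>. INF c. average (ball x \<rho>) (\<lambda>y. \<bar>u y - c\<bar>)) \<longlongrightarrow> 0) (at_right 0)"
    if x: "x \<in> \<Omega>" and lim: "(mean_oscillation p u x \<longlongrightarrow> 0) (at_right 0)" for x
  proof (rule tendstoI)
    fix e :: real assume e: "e > 0"
    \<comment> \<open>\<open>\<delta>\<close> is fixed before the radius tends to 0, so the possibly
      large factor \<open>\<delta> powr (1 - p)\<close> multiplies a quantity tending to 0.\<close>
    define \<delta> where "\<delta> = e / 2"
    have \<delta>: "\<delta> > 0" using e by (simp add: \<delta>_def)
    have "((\<lambda>\<rho>. \<delta> + \<delta> powr (1 - p) * mean_oscillation p u x \<rho>) \<longlongrightarrow> \<delta> + \<delta> powr (1 - p) * 0) (at_right 0)"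
      by (intro tendsto_intros lim)
    then have "eventually (\<lambda>\<rho>. \<delta> + \<delta> powr (1 - p) * mean_oscillation p u x \<rho> < e) (at_right 0)"
      by (rule order_tendstoD) (use e in \<open>simp add: \<delta>_def\<close>)
    moreover have "eventually (\<lambda>\<rho>::real. \<rho> > 0) (at_right 0)"
      by (rule eventually_at_right_less)
    ultimately show "eventually (\<lambda>\<rho>. dist (INF c. average (ball x \<rho>) (\<lambda>y. \<bar>u y - c\<bar>)) 0 < e) (at_right 0)"
      using eventually_cball_subset[OF \<Omega> x]
    proof eventually_elim
      fix \<rho> :: real
      assume *: "\<delta> + \<delta> powr (1 - p) * mean_oscillation p u x \<rho> < e" "\<rho> > 0" "cball x \<rho> \<subseteq> \<Omega>"
      have "u \<in> borel_measurable (lebesgue_on (ball x \<rho>))"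
        by (rule measurable_restrict_mono[of _ _ \<Omega>]) (use u * in \<open>auto simp: W1p_def Lp_def\<close>)
      from INF_average_le[OF p \<delta> *(2) this int[OF *(2,3)]]
      have "(INF c. average (ball x \<rho>) (\<lambda>y. \<bar>u y - c\<bar>)) < e"
        using *(1) by linarith
      moreover have "0 \<le> (INF c. average (ball x \<rho>) (\<lambda>y. \<bar>u y - c\<bar>))"
        by (rule cINF_greatest) (auto intro: average_nonneg)
      ultimately show "dist (INF c. average (ball x \<rho>) (\<lambda>y. \<bar>u y - c\<bar>)) 0 < e"
        by simp
    qed
  qed
  then show ?thesis by (auto simp: singular_set_def)
qed

text \<open>Failure of convergence comes with a threshold depending on the point, whereas the
  density lemma takes a common one; hence the sets \<open>E n\<close>, whose countable union is
  still null.\<close>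

lemma hausdorff_measure_mean_oscillation:
  fixes \<Omega> :: "'a::euclidean_space set"
  assumes \<Omega>: "open \<Omega>" and p: "1 < p" "p \<le> real DIM('a)" and u: "u \<in> W1p p \<Omega>"
  shows "hausdorff_measure (real DIM('a) - p)
    {x \<in> \<Omega>. \<not> (mean_oscillation p u x \<longlongrightarrow> 0) (at_right 0)} = 0"
proof -
  define s where "s = real DIM('a) - p"
  obtain \<nu> :: "'a measure" where \<nu>: "finite_measure \<nu>" "sets \<nu> = sets borel"
    "absolutely_continuous lborel \<nu>"
    "\<And>x r. r > 0 \<Longrightarrow> cball x r \<subseteq> \<Omega> \<Longrightarrow>
      mean_oscillation p u x r * measure lborel (ball x r)
        \<le> 2 ^ DIM('a) * (2 * r) powr p * measure \<nu> (ball x r)"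
    using W1p_mean_oscillation_le[OF \<Omega> p(1) u] by metis
  interpret finite_measure \<nu> by fact
  \<comment> \<open>The Poincare constant over the volume of the unit ball. The volume of a ball
    contributes \<open>r ^ DIM('a)\<close> and the constant \<open>r powr p\<close>, whose quotient
    is \<open>r powr s\<close>.\<close>
  define K where "K = 2 ^ DIM('a) * 2 powr p / unit_ball_vol (real DIM('a))"
  have \<omega>: "unit_ball_vol (real DIM('a)) \<noteq> 0"
    using unit_ball_vol_pos[of "real DIM('a)"] by linarith
  have K: "K > 0" by (simp add: K_def)
  have le: "mean_oscillation p u x r * r powr s \<le> K * measure \<nu> (ball x r)"
    if r: "r > 0" and sub: "cball x r \<subseteq> \<Omega>" for x r
  proof -
    have "r powr p * (mean_oscillation p u x r * r powr s) * unit_ball_vol (real DIM('a))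
        = mean_oscillation p u x r * measure lborel (ball x r)"
      using r by (simp add: content_ball s_def powr_realpow powr_diff)
    also have "\<dots> \<le> 2 ^ DIM('a) * (2 * r) powr p * measure \<nu> (ball x r)"
      by (rule \<nu>(4)[OF that])
    also have "\<dots> = r powr p * (K * measure \<nu> (ball x r)) * unit_ball_vol (real DIM('a))"
      using r \<omega> by (simp add: K_def powr_mult)
    finally show ?thesis
      using r by simp
  qed
  define E where "E n = {x \<in> \<Omega>. \<forall>\<eta>>0. \<exists>\<rho>. 0 < \<rho> \<and> \<rho> < \<eta> \<and>
      ennreal (1 / (K * real (Suc n)) * \<rho> powr s) \<le> emeasure \<nu> (ball x \<rho>)}" for n
  have "hausdorff_measure s (E n) = 0" for n
  proof (rule hausdorff_measure_upper_density_0[OF \<nu>(1-3)])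
    show "0 \<le> s" "s < real DIM('a)" using p by (auto simp: s_def)
    show "1 / (K * real (Suc n)) > 0" using K by simp
  qed (auto simp: E_def)
  then have zero: "hausdorff_measure s (\<Union>n. E n) = 0"
    by (rule hausdorff_measure_UN_0)
  have sub: "{x \<in> \<Omega>. \<not> (mean_oscillation p u x \<longlongrightarrow> 0) (at_right 0)} \<subseteq> (\<Union>n. E n)"
  proof clarify
    fix x assume x: "x \<in> \<Omega>" and "\<not> (mean_oscillation p u x \<longlongrightarrow> 0) (at_right 0)"
    then obtain e where e: "e > 0" "\<And>\<eta>. \<eta> > 0 \<Longrightarrow> \<exists>\<rho>. 0 < \<rho> \<and> \<rho> < \<eta> \<and> e \<le> mean_oscillation p u x \<rho>"
      using not_tendsto_0_at_rightD[of "mean_oscillation p u x"] mean_oscillation_nonneg by metis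
    obtain n where n: "1 / real (Suc n) < e" using e(1) nat_approx_posE by blast
    obtain d where d: "d > 0" "cball x d \<subseteq> \<Omega>" using \<Omega> x open_contains_cball by blast
    have "\<exists>\<rho>. 0 < \<rho> \<and> \<rho> < \<eta> \<and> ennreal (1 / (K * real (Suc n)) * \<rho> powr s) \<le> emeasure \<nu> (ball x \<rho>)"
      if \<eta>: "\<eta> > 0" for \<eta>
    proof -
      \<comment> \<open>Radii below \<open>d\<close> keep the closed ball in
        \<open>\<Omega>\<close>, where the bound \<open>le\<close> applies.\<close>
      obtain \<rho> where \<rho>: "0 < \<rho>" "\<rho> < min \<eta> d" "e \<le> mean_oscillation p u x \<rho>"
        using e(2)[of "min \<eta> d"] \<eta> d(1) by auto
      have "cball x \<rho> \<subseteq> \<Omega>" using d(2) \<rho>(2) by (auto simp: subset_iff)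
      have "1 / real (Suc n) * \<rho> powr s \<le> mean_oscillation p u x \<rho> * \<rho> powr s"
        using n \<rho>(3) by (intro mult_right_mono) auto
      also have "\<dots> \<le> K * measure \<nu> (ball x \<rho>)"
        by (rule le) fact+
      finally have "1 / real (Suc n) * \<rho> powr s / K \<le> measure \<nu> (ball x \<rho>)"
        using K by (simp add: pos_divide_le_eq mult_ac)
      then have "1 / (K * real (Suc n)) * \<rho> powr s \<le> measure \<nu> (ball x \<rho>)"
        by (simp add: mult.commute)
      then show ?thesis using \<rho> by (auto simp: emeasure_eq_measure intro!: ennreal_leI)
    qed
    with x show "x \<in> (\<Union>n. E n)" by (auto simp: E_def)
  qed
  show ?thesis
    using hausdorff_measure_mono[OF sub, of s] unfolding zero by (simp add: s_def)
qed

theorem theorem1p8: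
  fixes \<Omega> :: "(real ^ 'n) set" and u :: "real ^ 'n \<Rightarrow> real" and p :: real
  assumes "open \<Omega>"
    and "1 < p" and "p \<le> real CARD('n)"
    and "u \<in> W1p p \<Omega>"
  shows "hausdorff_measure (real CARD('n) - p)
           {x \<in> \<Omega>. \<not> ((\<lambda>\<rho>. average (ball x \<rho>) (\<lambda>y. \<bar>u y - average (ball x \<rho>) u\<bar> powr p))
                       \<longlongrightarrow> 0) (at_right 0)} = 0
       \<and> hausdorff_measure (real CARD('n) - p) (singular_set \<Omega> u) = 0"
proof -
  have dim: "DIM(real ^ 'n) = CARD('n)" by simp
  have *: "hausdorff_measure (real CARD('n) - p)
      {x \<in> \<Omega>. \<not> (mean_oscillation p u x \<longlongrightarrow> 0) (at_right 0)} = 0"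
    using hausdorff_measure_mean_oscillation[OF assms(1,2) _ assms(4)] assms(3) unfolding dim by simp
  moreover from * have "hausdorff_measure (real CARD('n) - p) (singular_set \<Omega> u) = 0"
    using hausdorff_measure_mono[OF singular_set_subset[OF assms(1,2,4)], of "real CARD('n) - p"]
    by simp
  ultimately show ?thesis
    by (simp add: mean_oscillation_def [abs_def])
qed

end
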